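(* Let $\tilde H$ be a Hermitian operator on a finite-dimensional Hilbert space, let $|\tilde\psi\rangle$ be a nondegenerate eigenstate of $\tilde H$ with eigenvalue $E$, and let $\{\omega_j\}$ be the energy differences between $E$ and the other eigenvalues $E_j$ of $\tilde H$ (corresponding to the other eigenstates $|\tilde\psi_j\rangle$). Let $T$ be a real random variable with characteristic function $\Phi(\omega)=\mathbb E[e^{i\omega T}]$, and let $\mathcal R^T$ be the quantum operation $\mathcal R^T(\rho)=\mathbb E\big[e^{-i\tilde H T}\rho\, e^{i\tilde H T}\big]$. Then there exists a quantum operation $\mathcal E$ such that for all states $\rho$, $$\|(M^{\mathcal E}-\mathcal R^T)(\rho)\|_{\rm tr}\ \le\ \epsilon=\sup_{\omega_j}|\Phi(\omega_j)|,$$ where $M^{\mathcal E}(\rho)=P\rho P+\mathcal E\big((\mathbb 1-P)\rho(\mathbb 1-P)\big)$ with $P=|\tilde\psi\rangle\langle\tilde\psi|$.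
   Context: $\|A\|_{\rm tr}=\mathrm{tr}|A|$ denotes the trace norm. A quantum operation is a completely positive trace-preserving map. Note $|\Phi(-\omega)|=|\Phi(\omega)|$, so the sign convention for the energy differences is immaterial. *)

theory Defs
  imports "Jordan_Normal_Form.Schur_Decomposition" "HOL-Probability.Probability"
begin

definition mat_trace :: "complex mat \<Rightarrow> complex" where
  "mat_trace A = (\<Sum>i<dim_row A. A $$ (i, i))"

definition hermitian_mat :: "nat \<Rightarrow> complex mat \<Rightarrow> bool" where
  "hermitian_mat n A \<longleftrightarrow> A \<in> carrier_mat n n \<and> mat_adjoint A = A"

definition psd_mat :: "nat \<Rightarrow> complex mat \<Rightarrow> bool" where
  "psd_mat n A \<longleftrightarrow> hermitian_mat n A \<and>
     (\<forall>v \<in> carrier_vec n. Im ((A *\<^sub>v v) \<bullet>c v) = 0 \<and> 0 \<le> Re ((A *\<^sub>v v) \<bullet>c v))"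

definition density_mat :: "nat \<Rightarrow> complex mat \<Rightarrow> bool" where
  "density_mat n \<rho> \<longleftrightarrow> psd_mat n \<rho> \<and> mat_trace \<rho> = 1"

text \<open>|A| = sqrt(A^* A), the unique positive semidefinite square root.\<close>
definition mat_abs :: "complex mat \<Rightarrow> complex mat" where
  "mat_abs A = (THE B. psd_mat (dim_col A) B \<and> B * B = mat_adjoint A * A)"

text \<open>Trace norm  ||A||_tr = tr |A|  (a real number, as tr|A| is real).\<close>
definition trace_norm :: "complex mat \<Rightarrow> real" where
  "trace_norm A = Re (mat_trace (mat_abs A))"

definition mat_exp :: "complex mat \<Rightarrow> complex mat" where
  "mat_exp A = Matrix.mat (dim_row A) (dim_col A)
     (\<lambda>(i, j). \<Sum>k. (A ^\<^sub>m k) $$ (i, j) / of_nat (fact k))"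

text \<open>Complete positivity: for every k, id_k (x) Phi maps PSD (k n)x(k n) matrices
to PSD matrices. A (k n)x(k n) matrix is viewed as a k x k array of n x n blocks.\<close>
definition block_of :: "nat \<Rightarrow> complex mat \<Rightarrow> nat \<Rightarrow> nat \<Rightarrow> complex mat" where
  "block_of n X a b = Matrix.mat n n (\<lambda>(i, j). X $$ (a * n + i, b * n + j))"

definition ampliate :: "nat \<Rightarrow> nat \<Rightarrow> (complex mat \<Rightarrow> complex mat) \<Rightarrow> complex mat \<Rightarrow> complex mat" where
  "ampliate k n \<Phi> X = Matrix.mat (k * n) (k * n)
     (\<lambda>(i, j). \<Phi> (block_of n X (i div n) (j div n)) $$ (i mod n, j mod n))"

definition quantum_operation :: "nat \<Rightarrow> (complex mat \<Rightarrow> complex mat) \<Rightarrow> bool" where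
  "quantum_operation n \<Phi> \<longleftrightarrow>
     (\<forall>X \<in> carrier_mat n n. \<Phi> X \<in> carrier_mat n n) \<and>
     (\<forall>X \<in> carrier_mat n n. \<forall>Y \<in> carrier_mat n n. \<forall>c a :: complex.
        \<Phi> (c \<cdot>\<^sub>m X + a \<cdot>\<^sub>m Y) = c \<cdot>\<^sub>m \<Phi> X + a \<cdot>\<^sub>m \<Phi> Y) \<and>
     (\<forall>X \<in> carrier_mat n n. mat_trace (\<Phi> X) = mat_trace X) \<and>
     (\<forall>k. \<forall>X. psd_mat (k * n) X \<longrightarrow> psd_mat (k * n) (ampliate k n \<Phi> X))"

definition proj :: "complex Matrix.vec \<Rightarrow> complex mat" where
  "proj \<psi> = Matrix.mat (dim_vec \<psi>) (dim_vec \<psi>) (\<lambda>(i, j). \<psi> $ i * cnj (\<psi> $ j))"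

definition char_fun :: "'s measure \<Rightarrow> ('s \<Rightarrow> real) \<Rightarrow> real \<Rightarrow> complex" where
  "char_fun M T \<omega> = (\<integral>x. exp (\<i> * complex_of_real (\<omega> * T x)) \<partial>M)"

definition random_evolution ::
  "nat \<Rightarrow> complex mat \<Rightarrow> 's measure \<Rightarrow> ('s \<Rightarrow> real) \<Rightarrow> complex mat \<Rightarrow> complex mat" where
  "random_evolution n H M T \<rho> = Matrix.mat n n (\<lambda>(i, j).
     \<integral>x. (mat_exp ((- \<i> * complex_of_real (T x)) \<cdot>\<^sub>m H) * \<rho>
            * mat_exp ((\<i> * complex_of_real (T x)) \<cdot>\<^sub>m H)) $$ (i, j) \<partial>M)"

definition measure_map ::
  "nat \<Rightarrow> complex mat \<Rightarrow> (complex mat \<Rightarrow> complex mat) \<Rightarrow> complex mat \<Rightarrow> complex mat" where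
  "measure_map n P \<E> \<rho> = P * \<rho> * P + \<E> ((1\<^sub>m n - P) * \<rho> * (1\<^sub>m n - P))"

text \<open>Eigenvalues of H other than E (Hermitian, so all eigenvalues are real).\<close>
definition other_eigenvalues :: "nat \<Rightarrow> complex mat \<Rightarrow> real \<Rightarrow> real set" where
  "other_eigenvalues n H E = {e. e \<noteq> E \<and>
     (\<exists>v \<in> carrier_vec n. v \<noteq> 0\<^sub>v n \<and> H *\<^sub>v v = complex_of_real e \<cdot>\<^sub>v v)}"

end

theory Submission
  imports Defs "Jordan_Normal_Form.Spectral_Radius"
begin

text \<open>Take \<open>\<E>\<close> to be the random evolution itself. In an eigenbasis of \<open>H\<close> it multiplies the matrix
  entry \<open>(k, l)\<close> by \<open>\<Phi>(d\<^sub>l - d\<^sub>k)\<close>; hence it fixes the \<open>\<psi>\<close>-block and preserves the complementary block, and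
  the difference of the two maps consists only of the cross terms \<open>w \<psi>\<^sup>* + \<psi> w\<^sup>*\<close>, where \<open>w\<close> has entries
  \<open>- \<Phi>(E - d\<^sub>j) \<rho>\<^sub>j\<^sub>k\<close>. Such a matrix has trace norm \<open>2 norm w\<close>, and positivity of \<open>\<rho>\<close> bounds its
  off-diagonal column by \<open>sqrt (p (1 - p)) \<le> 1/2\<close>, where \<open>p = \<rho>\<^sub>k\<^sub>k\<close>.\<close>

unbundle no vec_syntax

section \<open>Unitary diagonalisation of Hermitian matrices\<close>

text \<open>Two features of the definitions shape the proof. The trace norm goes through a definite
  description of the square root, so nothing can be computed before positive semidefinite square
  roots are known to be unique; this already needs the spectral theorem. Afterwards the absolute
  value of the cross terms is exhibited and checked, with no singular value decomposition. Complete
  positivity concerns every ampliation; it holds because an expectation of conjugations stays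
  positive, whatever the dimension of the ancilla. Choosing the evolution itself as \<E> makes
  degeneracy among the other eigenvalues harmless: both maps act alike on the complementary block,
  so coherences inside it cancel exactly. Nondegeneracy of E ensures that every surviving frequency
  E - d_j is counted in the supremum. The column bound comes from the 2 x 2 principal minors, summed
  using trace one; its maximum 1/2 cancels the factor 2 of the trace norm, which is why the supremum
  carries the constant one.\<close>

lemma dim_mat_adjoint [simp]:
  "dim_row (mat_adjoint A) = dim_col A" "dim_col (mat_adjoint A) = dim_row A"
  by (auto simp: mat_adjoint_def)

lemma mat_adjoint_carrier [simp]: "A \<in> carrier_mat m n \<Longrightarrow> mat_adjoint A \<in> carrier_mat n m"
  by (intro carrier_matI) auto

lemma index_mat_adjoint [simp]:
  fixes A :: "complex mat"
  shows "i < dim_col A \<Longrightarrow> j < dim_row A \<Longrightarrow> mat_adjoint A $$ (i, j) = cnj (A $$ (j, i))"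
  by (simp add: mat_adjoint_def mat_of_rows_index)

lemma mat_adjoint_adjoint [simp]: "mat_adjoint (mat_adjoint A) = (A :: complex mat)"
  by (intro eq_matI) auto

lemma mat_adjoint_mult:
  fixes A B :: "complex mat"
  assumes "A \<in> carrier_mat m n" "B \<in> carrier_mat n p"
  shows "mat_adjoint (A * B) = mat_adjoint B * mat_adjoint A"
  using assms by (intro eq_matI) (auto simp: scalar_prod_def mult.commute intro!: sum.cong)

lemma index_mult_mat_sum:
  fixes A B :: "complex mat"
  assumes "A \<in> carrier_mat a n" "B \<in> carrier_mat n b" "i < a" "j < b"
  shows "(A * B) $$ (i, j) = (\<Sum>k<n. A $$ (i, k) * B $$ (k, j))"
  using assms by (auto simp: scalar_prod_def lessThan_atLeast0 intro!: sum.cong)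

lemma index_mult_mat3:
  fixes A B C :: "complex mat"
  assumes "A \<in> carrier_mat a n" "B \<in> carrier_mat n m" "C \<in> carrier_mat m b" "i < a" "j < b"
  shows "(A * B * C) $$ (i, j) = (\<Sum>k<n. \<Sum>l<m. A $$ (i, k) * B $$ (k, l) * C $$ (l, j))"
proof -
  have "(A * B * C) $$ (i, j) = (\<Sum>l<m. (\<Sum>k<n. A $$ (i, k) * B $$ (k, l)) * C $$ (l, j))"
    unfolding index_mult_mat_sum[OF mult_carrier_mat[OF assms(1,2)] assms(3-5)]
    by (intro sum.cong refl arg_cong2[of _ _ _ _ "(*)"] index_mult_mat_sum[OF assms(1,2) assms(4)]) simp
  also have "\<dots> = (\<Sum>k<n. \<Sum>l<m. A $$ (i, k) * B $$ (k, l) * C $$ (l, j))"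
    by (simp add: sum_distrib_right) (rule sum.swap)
  finally show ?thesis .
qed

lemma index_mult_mat_vec_sum:
  fixes A :: "complex mat"
  assumes "A \<in> carrier_mat m n" "v \<in> carrier_vec n" "i < m"
  shows "(A *\<^sub>v v) $ i = (\<Sum>j<n. A $$ (i, j) * v $ j)"
  using assms by (auto simp: scalar_prod_def lessThan_atLeast0 intro!: sum.cong)

lemma cscalar_prod_sum:
  fixes v w :: "complex Matrix.vec"
  assumes "w \<in> carrier_vec n"
  shows "v \<bullet>c w = (\<Sum>i<n. v $ i * cnj (w $ i))"
  using assms by (auto simp: scalar_prod_def lessThan_atLeast0 intro!: sum.cong)

lemma cscalar_prod_mult_mat_vec:
  fixes A :: "complex mat"
  assumes A: "A \<in> carrier_mat m n" and v: "v \<in> carrier_vec n" and w: "w \<in> carrier_vec m"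
  shows "(A *\<^sub>v v) \<bullet>c w = v \<bullet>c (mat_adjoint A *\<^sub>v w)"
proof -
  have "(A *\<^sub>v v) \<bullet>c w = (\<Sum>i<m. \<Sum>j<n. A $$ (i, j) * v $ j * cnj (w $ i))"
    unfolding cscalar_prod_sum[OF w]
    by (simp add: index_mult_mat_vec_sum[OF A v] sum_distrib_right)
  also have "\<dots> = (\<Sum>j<n. \<Sum>i<m. A $$ (i, j) * v $ j * cnj (w $ i))"
    by (rule sum.swap)
  also have "\<dots> = v \<bullet>c (mat_adjoint A *\<^sub>v w)"
    unfolding cscalar_prod_sum[OF mult_mat_vec_carrier[OF mat_adjoint_carrier[OF A] w]] using A
    by (auto simp: index_mult_mat_vec_sum[OF mat_adjoint_carrier[OF A] w] sum_distrib_left mult_ac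
        simp del: index_mult_mat_vec intro!: sum.cong)
  finally show ?thesis .
qed

lemma quadratic_form_eq_sum:
  fixes A :: "complex mat"
  assumes "A \<in> carrier_mat n n" "v \<in> carrier_vec n"
  shows "(A *\<^sub>v v) \<bullet>c v = (\<Sum>i<n. \<Sum>j<n. A $$ (i, j) * v $ j * cnj (v $ i))"
  unfolding cscalar_prod_sum[OF assms(2)]
  by (simp add: index_mult_mat_vec_sum[OF assms] sum_distrib_right)

lemma cscalar_prod_self:
  fixes v :: "complex Matrix.vec"
  assumes "v \<in> carrier_vec n"
  shows "v \<bullet>c v = of_real (\<Sum>i<n. (cmod (v $ i))\<^sup>2)"
  unfolding cscalar_prod_sum[OF assms] by (simp flip: complex_norm_square)

section \<open>Unitary conjugation and the spectral theorem\<close>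

definition unitary_mat :: "nat \<Rightarrow> complex mat \<Rightarrow> bool" where
  "unitary_mat n U \<longleftrightarrow> U \<in> carrier_mat n n \<and> mat_adjoint U * U = 1\<^sub>m n"

definition diag_of :: "nat \<Rightarrow> (nat \<Rightarrow> complex) \<Rightarrow> complex mat" where
  "diag_of n f = Matrix.mat n n (\<lambda>(i, j). if i = j then f i else 0)"

lemma diag_of_carrier [simp]: "diag_of n f \<in> carrier_mat n n"
  and dim_diag_of [simp]: "dim_row (diag_of n f) = n" "dim_col (diag_of n f) = n"
  by (auto simp: diag_of_def)

lemma index_diag_of [simp]:
  "i < n \<Longrightarrow> j < n \<Longrightarrow> diag_of n f $$ (i, j) = (if i = j then f i else 0)"
  by (simp add: diag_of_def)

text \<open>For square matrices a left inverse is a right inverse, so the one-sided equation in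
  \<open>unitary_mat\<close> is enough.\<close>

lemma unitary_matD:
  assumes "unitary_mat n U"
  shows "U \<in> carrier_mat n n" "mat_adjoint U * U = 1\<^sub>m n" "U * mat_adjoint U = 1\<^sub>m n"
  using assms mat_mult_left_right_inverse[of "mat_adjoint U" n U] by (auto simp: unitary_mat_def)

lemma unitary_mat_mult:
  assumes "unitary_mat n U" "unitary_mat n V"
  shows "unitary_mat n (U * V)"
proof -
  note U = unitary_matD[OF assms(1)] and V = unitary_matD[OF assms(2)]
  have "mat_adjoint (U * V) * (U * V) = mat_adjoint V * mat_adjoint U * (U * V)"
    using U V by (simp add: mat_adjoint_mult)
  also have "\<dots> = mat_adjoint V * (mat_adjoint U * U * V)"
    using U(1) V(1) by (simp add: assoc_mult_mat[of _ n n _ n _ n] mult_carrier_mat[of _ n n _ n])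
  also have "\<dots> = 1\<^sub>m n" using U V by simp
  finally show ?thesis using U V by (simp add: unitary_mat_def)
qed

lemma unitary_conj_cancel:
  assumes "unitary_mat n U" "X \<in> carrier_mat n n"
  shows "U * (mat_adjoint U * X * U) * mat_adjoint U = X"
    "mat_adjoint U * (U * X * mat_adjoint U) * U = X"
proof -
  note U = unitary_matD[OF assms(1)]
  have "U * (mat_adjoint U * X * U) * mat_adjoint U = (U * mat_adjoint U) * X * (U * mat_adjoint U)"
    using U(1) assms(2) by (simp add: assoc_mult_mat[of _ n n _ n _ n] mult_carrier_mat[of _ n n _ n])
  then show "U * (mat_adjoint U * X * U) * mat_adjoint U = X"
    using U assms(2) by simp
  have "mat_adjoint U * (U * X * mat_adjoint U) * U = (mat_adjoint U * U) * X * (mat_adjoint U * U)"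
    using U(1) assms(2) by (simp add: assoc_mult_mat[of _ n n _ n _ n] mult_carrier_mat[of _ n n _ n])
  then show "mat_adjoint U * (U * X * mat_adjoint U) * U = X"
    using U assms(2) by simp
qed

lemma unitary_conj_mult:
  assumes "unitary_mat n U" "X \<in> carrier_mat n n" "Y \<in> carrier_mat n n"
  shows "(U * X * mat_adjoint U) * (U * Y * mat_adjoint U) = U * (X * Y) * mat_adjoint U"
proof -
  note U = unitary_matD[OF assms(1)]
  have "(U * X * mat_adjoint U) * (U * Y * mat_adjoint U)
      = U * X * ((mat_adjoint U * U) * Y) * mat_adjoint U"
    using U(1) assms(2,3) by (simp add: assoc_mult_mat[of _ n n _ n _ n] mult_carrier_mat[of _ n n _ n] mult_carrier_mat[of _ n n _ n])
  also have "\<dots> = U * (X * Y) * mat_adjoint U"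
    using U assms(2,3) by (simp add: assoc_mult_mat[of _ n n _ n _ n] mult_carrier_mat[of _ n n _ n])
  finally show ?thesis .
qed

lemma adjoint_conj:
  fixes U X :: "complex mat"
  assumes "U \<in> carrier_mat m n" "X \<in> carrier_mat n n"
  shows "mat_adjoint (U * X * mat_adjoint U) = U * mat_adjoint X * mat_adjoint U"
proof -
  have "mat_adjoint (U * X * mat_adjoint U) = U * (mat_adjoint X * mat_adjoint U)"
    using assms by (subst mat_adjoint_mult[of _ m n _ m])
      (auto simp: mat_adjoint_mult[OF assms] intro: mult_carrier_mat)
  then show ?thesis using assms by (simp add: assoc_mult_mat[of _ m n _ n _ m])
qed

text \<open>Complete \<open>v\<close> to a basis that starts with \<open>v\<close>; Gram-Schmidt
  leaves its first vector unchanged, and dividing each column by its length makes the matrix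
  unitary. The factor \<open>c\<close> is the inverse length of \<open>v\<close>.\<close>

lemma exists_unitary_first_col:
  fixes v :: "complex Matrix.vec"
  assumes v: "v \<in> carrier_vec n" and v0: "v \<noteq> 0\<^sub>v n"
  shows "\<exists>U c. unitary_mat n U \<and> c \<noteq> 0 \<and> col U 0 = c \<cdot>\<^sub>v v"
proof -
  interpret cof_vec_space n "TYPE(complex)" .
  have n: "n \<noteq> 0" using v v0 by auto
  define b where "b = basis_completion v"
  define ws where "ws = gram_schmidt n b"
  from basis_completion[OF v v0, folded b_def]
  have dist_b: "distinct b" and indep: "\<not> lin_dep (set b)" and b: "set b \<subseteq> carrier_vec n"
    and hdb: "hd b = v" and len_b: "length b = n" by auto
  from hdb len_b n obtain vs where bv: "b = v # vs" by (cases b) auto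
  from gram_schmidt_result[OF b dist_b indep refl, folded ws_def]
  have ws: "set ws \<subseteq> carrier_vec n" "corthogonal ws" "length ws = n"
    by (auto simp: len_b)
  from gram_schmidt_hd[OF v, of vs, folded bv] have hdws: "hd ws = v" unfolding ws_def .
  have ws0: "ws ! 0 = v" using hdws ws(3) n hd_conv_nth[of ws] by auto
  have wsc: "ws ! i \<in> carrier_vec n" if "i < n" for i
    using ws that by auto
  define s where "s i = sqrt (\<Sum>k<n. (cmod (ws ! i $ k))\<^sup>2)" for i
  have s2: "ws ! i \<bullet>c (ws ! i) = of_real ((s i)\<^sup>2)" if "i < n" for i
    by (simp add: cscalar_prod_self[OF wsc[OF that]] s_def sum_nonneg)
  \<comment> \<open>\<open>corthogonal\<close> states that a product vanishes exactly when the
    indices differ, so it also yields nonzero lengths.\<close>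
  have s0: "s i \<noteq> 0" if "i < n" for i
    using s2[OF that] corthogonalD[OF ws(2), of i i] that ws(3) by auto
  define U where "U = Matrix.mat n n (\<lambda>(i, j). ws ! j $ i / of_real (s j))"
  have orth: "(\<Sum>k<n. cnj (ws ! i $ k) * ws ! j $ k) = (if i = j then of_real ((s i)\<^sup>2) else 0)"
    if "i < n" "j < n" for i j
  proof -
    have "(\<Sum>k<n. cnj (ws ! i $ k) * ws ! j $ k) = ws ! j \<bullet>c (ws ! i)"
      by (simp add: cscalar_prod_sum[OF wsc[OF that(1)]] mult.commute)
    then show ?thesis using s2 corthogonalD[OF ws(2), of j i] that ws(3) by auto
  qed
  have "mat_adjoint U * U = 1\<^sub>m n"
  proof (rule eq_matI)
    fix i j assume "i < dim_row (1\<^sub>m n)" "j < dim_col (1\<^sub>m n)"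
    then have ij: "i < n" "j < n" by auto
    have "(mat_adjoint U * U) $$ (i, j)
        = (\<Sum>k<n. cnj (ws ! i $ k) * ws ! j $ k) / (of_real (s i) * of_real (s j))"
      using ij by (simp add: U_def scalar_prod_def lessThan_atLeast0 sum_divide_distrib)
    also have "\<dots> = 1\<^sub>m n $$ (i, j)"
      using ij s0[OF ij(1)] s0[OF ij(2)] by (simp add: orth[OF ij] power2_eq_square)
    finally show "(mat_adjoint U * U) $$ (i, j) = 1\<^sub>m n $$ (i, j)" .
  qed (auto simp: U_def)
  then have "unitary_mat n U" by (auto simp: unitary_mat_def U_def)
  moreover have "col U 0 = (1 / of_real (s 0)) \<cdot>\<^sub>v v"
    using n ws0 v by (intro eq_vecI) (auto simp: U_def)
  ultimately show ?thesis using s0[of 0] n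
    by (intro exI[of _ U] exI[of _ "1 / of_real (s 0)"]) auto
qed

lemma mat_adjoint_four_block:
  fixes A B C D :: "complex mat"
  assumes "A \<in> carrier_mat r1 c1" "B \<in> carrier_mat r1 c2" "C \<in> carrier_mat r2 c1" "D \<in> carrier_mat r2 c2"
  shows "mat_adjoint (four_block_mat A B C D) =
    four_block_mat (mat_adjoint A) (mat_adjoint C) (mat_adjoint B) (mat_adjoint D)"
  using assms by (intro eq_matI) auto

lemma hermitian_matI:
  assumes "A \<in> carrier_mat n n" "\<And>i j. i < n \<Longrightarrow> j < n \<Longrightarrow> cnj (A $$ (j, i)) = A $$ (i, j)"
  shows "hermitian_mat n A"
  unfolding hermitian_mat_def using assms by (auto intro!: eq_matI)

text \<open>Deflation: with an eigenvector as first column of a unitary \<open>W\<close>, the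
  conjugated matrix splits into a 1 x 1 block and a Hermitian block of size one less, to which the
  induction hypothesis applies.\<close>

lemma hermitian_spectral:
  "hermitian_mat n H \<Longrightarrow> \<exists>U d. unitary_mat n U \<and>
     H = U * diag_of n (\<lambda>i. complex_of_real (d i)) * mat_adjoint U"
proof (induction n arbitrary: H)
  case 0
  then show ?case
    by (intro exI[of _ "1\<^sub>m 0"] exI[of _ "\<lambda>_. 0"])
       (auto simp: unitary_mat_def hermitian_mat_def intro!: eq_matI)
next
  case (Suc m)
  let ?n = "Suc m"
  have H: "H \<in> carrier_mat ?n ?n" and Hh: "mat_adjoint H = H"
    using Suc.prems by (auto simp: hermitian_mat_def)
  obtain e where "e \<in> spectrum H" using spectrum_non_empty[OF H] by auto
  then obtain v where v: "v \<in> carrier_vec ?n" "v \<noteq> 0\<^sub>v ?n" "H *\<^sub>v v = e \<cdot>\<^sub>v v"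
    using H by (auto simp: spectrum_def eigenvalue_def eigenvector_def)
  obtain W c where W: "unitary_mat ?n W" and c: "c \<noteq> 0" "col W 0 = c \<cdot>\<^sub>v v"
    using exists_unitary_first_col[OF v(1,2)] by blast
  note W' = unitary_matD[OF W]
  define A where "A = mat_adjoint W * H * W"
  have A: "A \<in> carrier_mat ?n ?n" using W' H unfolding A_def by (intro mult_carrier_mat[of _ ?n ?n _ ?n] mat_adjoint_carrier)
  have Ah: "mat_adjoint A = A"
    using adjoint_conj[of "mat_adjoint W" ?n ?n H] W' H Hh by (simp add: A_def)
  have "col A 0 = mat_adjoint W *\<^sub>v (H *\<^sub>v col W 0)"
    unfolding A_def
    using W'(1) H col_mult2[of "mat_adjoint W" ?n ?n "H * W" ?n 0] col_mult2[of H ?n ?n W ?n 0]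
    by (simp add: assoc_mult_mat[of _ ?n ?n _ ?n _ ?n] mult_carrier_mat[of _ ?n ?n _ ?n] del: col_mult)
  also have "\<dots> = mat_adjoint W *\<^sub>v (e \<cdot>\<^sub>v col W 0)"
    using c v H by (simp add: mult_mat_vec[of _ ?n ?n] smult_smult_assoc mult.commute)
  also have "\<dots> = e \<cdot>\<^sub>v (mat_adjoint W *\<^sub>v col W 0)"
    by (rule mult_mat_vec[of _ ?n ?n]) (use W' in \<open>auto intro: carrier_vecI\<close>)
  also have "mat_adjoint W *\<^sub>v col W 0 = col (mat_adjoint W * W) 0"
    by (rule col_mult2[of _ ?n ?n _ ?n, symmetric]) (use W' in auto)
  finally have col0: "col A 0 = e \<cdot>\<^sub>v col (1\<^sub>m ?n) 0" using W' by simp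
  have Ai0: "A $$ (i, 0) = (if i = 0 then e else 0)" if "i < ?n" for i
    using arg_cong[OF col0, of "\<lambda>x. x $ i"] that A by auto
  \<comment> \<open>Hermiticity carries the zeros of the first column over to the first row;
    comparing both descriptions of the corner entry shows that the eigenvalue is real.\<close>
  have A0i: "A $$ (0, i) = (if i = 0 then cnj e else 0)" if "i < ?n" for i
    using arg_cong[OF Ah, of "\<lambda>x. x $$ (0, i)"] Ai0[OF that] that A by auto
  have e: "e = of_real (Re e)" using Ai0[of 0] A0i[of 0] by (simp add: complex_eq_iff)
  have cnje: "cnj e = e" using Ai0[of 0] A0i[of 0] by simp
  define B where "B = Matrix.mat m m (\<lambda>(i, j). A $$ (Suc i, Suc j))"
  have AB: "A = four_block_mat (diag_of 1 (\<lambda>_. e)) (0\<^sub>m 1 m) (0\<^sub>m m 1) B"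
    using A by (intro eq_matI) (auto simp: B_def Ai0 A0i cnje gr0_conv_Suc)
  have "hermitian_mat m B"
  proof -
    have "cnj (B $$ (j, i)) = B $$ (i, j)" if "i < m" "j < m" for i j
      using arg_cong[OF Ah, of "\<lambda>x. x $$ (Suc i, Suc j)"] that A by (simp add: B_def)
    then show ?thesis by (intro hermitian_matI) (auto simp: B_def)
  qed
  then obtain V d where V: "unitary_mat m V"
    and B: "B = V * diag_of m (\<lambda>i. complex_of_real (d i)) * mat_adjoint V"
    using Suc.IH by blast
  note V' = unitary_matD[OF V]
  \<comment> \<open>The unitary of the smaller block is extended by the identity on the eigenvector
    already split off.\<close>
  define X where "X = four_block_mat (1\<^sub>m 1) (0\<^sub>m 1 m) (0\<^sub>m m 1) V"
  define d' where "d' i = (case i of 0 \<Rightarrow> Re e | Suc i \<Rightarrow> d i)" for i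
  have one_adj: "mat_adjoint (1\<^sub>m k) = (1\<^sub>m k :: complex mat)"
    and zero_adj: "mat_adjoint (0\<^sub>m k l) = (0\<^sub>m l k :: complex mat)" for k l
    by (intro eq_matI; auto)+
  have X: "X \<in> carrier_mat ?n ?n" using V' by (auto simp: X_def)
  have Xa: "mat_adjoint X = four_block_mat (1\<^sub>m 1) (0\<^sub>m 1 m) (0\<^sub>m m 1) (mat_adjoint V)"
    using V' unfolding X_def
    by (subst mat_adjoint_four_block[of _ 1 1 _ m _ m]) (auto simp: one_adj zero_adj)
  have "mat_adjoint X * X = 1\<^sub>m ?n"
    unfolding Xa unfolding X_def using V'
    by (subst mult_four_block_mat[of _ 1 1 _ m _ m _ _ 1 _ m])
       (auto simp: four_block_one_mat[of 1 m, simplified])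
  then have XU: "unitary_mat ?n X" using X by (simp add: unitary_mat_def)
  have D: "diag_of ?n (\<lambda>i. complex_of_real (d' i)) =
      four_block_mat (diag_of 1 (\<lambda>_. e)) (0\<^sub>m 1 m) (0\<^sub>m m 1) (diag_of m (\<lambda>i. complex_of_real (d i)))"
    using e by (intro eq_matI) (auto simp: d'_def gr0_conv_Suc)
  have AX: "A = X * diag_of ?n (\<lambda>i. complex_of_real (d' i)) * mat_adjoint X"
    unfolding AB D Xa B unfolding X_def using V'
    apply (subst mult_four_block_mat[of _ 1 1 _ m _ m _ _ 1 _ m]; simp?)
    apply (subst mult_four_block_mat[of _ 1 1 _ m _ m _ _ 1 _ m]; simp?)
    apply (subst left_add_zero_mat[of _ m m]; simp add: mult_carrier_mat[of _ m m _ m])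
    done
  have "H = W * A * mat_adjoint W"
    using unitary_conj_cancel(1)[OF W H] by (simp add: A_def)
  also have "\<dots> = (W * X) * diag_of ?n (\<lambda>i. complex_of_real (d' i)) * mat_adjoint (W * X)"
    using W' X unfolding AX
    by (simp add: mat_adjoint_mult[of _ ?n ?n _ ?n] assoc_mult_mat[of _ ?n ?n _ ?n _ ?n] mult_carrier_mat[of _ ?n ?n _ ?n])
  finally show ?case using unitary_mat_mult[OF W XU] by blast
qed

section \<open>Positive semidefinite matrices\<close>

lemma psd_matD:
  assumes "psd_mat n X"
  shows "X \<in> carrier_mat n n" "mat_adjoint X = X"
    "v \<in> carrier_vec n \<Longrightarrow> Im ((X *\<^sub>v v) \<bullet>c v) = 0"
    "v \<in> carrier_vec n \<Longrightarrow> 0 \<le> Re ((X *\<^sub>v v) \<bullet>c v)"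
  using assms by (auto simp: psd_mat_def hermitian_mat_def)

lemma psd_mat_cnj:
  assumes "psd_mat n X" "i < n" "j < n"
  shows "X $$ (j, i) = cnj (X $$ (i, j))"
  using arg_cong[OF psd_matD(2)[OF assms(1)], of "\<lambda>Y. Y $$ (j, i)"] psd_matD(1)[OF assms(1)] assms(2,3)
  by simp

text \<open>The quadratic form at \<open>v\<close> is the form of \<open>X\<close> at
  \<open>mat_adjoint B *\<^sub>v v\<close>. This serves changes of basis as well as positivity of
  the ampliated evolution.\<close>

lemma psd_mat_conj:
  assumes X: "psd_mat n X" and B: "B \<in> carrier_mat m n"
  shows "psd_mat m (B * X * mat_adjoint B)"
proof -
  note X' = psd_matD[OF X]
  have C: "B * X * mat_adjoint B \<in> carrier_mat m m"
    using X' B by (intro mult_carrier_mat[of _ m n] mat_adjoint_carrier)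
  have "(B * X * mat_adjoint B *\<^sub>v v) \<bullet>c v = (X *\<^sub>v (mat_adjoint B *\<^sub>v v)) \<bullet>c (mat_adjoint B *\<^sub>v v)"
    if v: "v \<in> carrier_vec m" for v
  proof -
    have w: "mat_adjoint B *\<^sub>v v \<in> carrier_vec n"
      using B v by (intro mult_mat_vec_carrier[of _ n m]) auto
    have "B * X * mat_adjoint B *\<^sub>v v = B *\<^sub>v (X *\<^sub>v (mat_adjoint B *\<^sub>v v))"
      using X'(1) B v w mult_carrier_mat[OF B X'(1)]
      by (simp add: assoc_mult_mat_vec[of _ m n _ m] assoc_mult_mat_vec[of _ m n _ n])
    then show ?thesis
      using cscalar_prod_mult_mat_vec[OF B mult_mat_vec_carrier[OF X'(1) w] v] by simp
  qed
  then show ?thesis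
    using C X' adjoint_conj[OF B X'(1)] B mult_mat_vec_carrier[of "mat_adjoint B" n m]
    by (auto simp: psd_mat_def hermitian_mat_def)
qed

lemma sum_lessThan_two:
  fixes f :: "nat \<Rightarrow> 'a::comm_monoid_add"
  assumes "j < n" "k < n" "j \<noteq> k" "\<And>i. i < n \<Longrightarrow> i \<noteq> j \<Longrightarrow> i \<noteq> k \<Longrightarrow> f i = 0"
  shows "(\<Sum>i<n. f i) = f j + f k"
proof -
  have "(\<Sum>i<n. f i) = (\<Sum>i\<in>{j, k}. f i)"
    using assms by (intro sum.mono_neutral_right) auto
  then show ?thesis using assms by simp
qed

lemma psd_mat_diag:
  assumes X: "psd_mat n X" and i: "i < n"
  shows "Im (X $$ (i, i)) = 0" "0 \<le> Re (X $$ (i, i))"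
proof -
  have "(X *\<^sub>v unit_vec n i) \<bullet>c unit_vec n i
      = (\<Sum>k<n. \<Sum>l<n. if k = i then if l = i then X $$ (i, i) else 0 else 0)"
    unfolding quadratic_form_eq_sum[OF psd_matD(1)[OF X] unit_vec_carrier]
    by (intro sum.cong refl) (auto simp: i)
  also have "\<dots> = (\<Sum>k<n. if k = i then X $$ (i, i) else 0)"
    by (intro sum.cong refl) (auto simp: i)
  also have "\<dots> = X $$ (i, i)" using i by simp
  finally show "Im (X $$ (i, i)) = 0" "0 \<le> Re (X $$ (i, i))"
    using psd_matD(3,4)[OF X unit_vec_carrier, of i] by simp_all
qed

text \<open>Nonnegativity of a 2 x 2 principal minor, obtained by testing the form on vectors
  supported on the two indices.\<close>

lemma psd_mat_minor:
  assumes X: "psd_mat n X" and jk: "j < n" "k < n" "j \<noteq> k"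
  shows "(cmod (X $$ (j, k)))\<^sup>2 \<le> Re (X $$ (j, j)) * Re (X $$ (k, k))"
proof -
  define x y z where "x = Re (X $$ (j, j))" and "y = Re (X $$ (k, k))" and "z = X $$ (j, k)"
  have xjj: "X $$ (j, j) = of_real x" and x0: "0 \<le> x"
    using psd_mat_diag[OF X jk(1)] by (auto simp: x_def complex_eq_iff)
  have ykk: "X $$ (k, k) = of_real y" using psd_mat_diag[OF X jk(2)] by (auto simp: y_def complex_eq_iff)
  have zkj: "X $$ (k, j) = cnj z" using psd_mat_cnj[OF X jk(1,2)] by (simp add: z_def)
  have key: "0 \<le> (cmod z)\<^sup>2 * r\<^sup>2 * x - 2 * r * s * (cmod z)\<^sup>2 + s\<^sup>2 * y" for r s :: real
  proof -
    \<comment> \<open>The factor \<open>- z\<close> in coordinate \<open>j\<close> turns both cross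
      terms into the same real number, \<open>- r * s * (cmod z)\<^sup>2\<close>.\<close>
    define v where "v = Matrix.vec n (\<lambda>i. if i = j then - z * of_real r else if i = k then of_real s else 0)"
    have v: "v \<in> carrier_vec n" by (simp add: v_def)
    have vj: "v $ j = - z * of_real r" and vk: "v $ k = of_real s" using jk by (auto simp: v_def)
    have row: "(\<Sum>l<n. X $$ (i, l) * v $ l * c) = X $$ (i, j) * v $ j * c + X $$ (i, k) * v $ k * c" for i c
      using jk by (intro sum_lessThan_two) (auto simp: v_def)
    have "(X *\<^sub>v v) \<bullet>c v = (X $$ (j, j) * v $ j * cnj (v $ j) + X $$ (j, k) * v $ k * cnj (v $ j))
        + (X $$ (k, j) * v $ j * cnj (v $ k) + X $$ (k, k) * v $ k * cnj (v $ k))"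
      unfolding quadratic_form_eq_sum[OF psd_matD(1)[OF X] v] row
      using jk by (intro sum_lessThan_two) (auto simp: v_def)
    also have "\<dots> = (z * cnj z) * of_real (r\<^sup>2 * x - 2 * r * s) + of_real (s\<^sup>2 * y)"
      unfolding xjj ykk zkj vj vk z_def[symmetric] by (simp add: algebra_simps power2_eq_square)
    also have "\<dots> = of_real ((cmod z)\<^sup>2 * (r\<^sup>2 * x - 2 * r * s) + s\<^sup>2 * y)"
      by (simp flip: complex_norm_square)
    finally have "Re ((X *\<^sub>v v) \<bullet>c v) = (cmod z)\<^sup>2 * (r\<^sup>2 * x - 2 * r * s) + s\<^sup>2 * y"
      by (simp only: Re_complex_of_real)
    then show ?thesis using psd_matD(4)[OF X v] by (simp add: algebra_simps)
  qed
  have "(cmod z)\<^sup>2 \<le> x * y"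
  proof (cases "z = 0 \<or> x = 0")
    case True
    have "z = 0"
    proof (rule ccontr)
      assume "z \<noteq> 0"
      with True have "x = 0" by auto
      \<comment> \<open>If \<open>x = 0\<close>, the form is linear in \<open>r\<close>; this value
        of \<open>r\<close>, with \<open>s = 1\<close>, would make it equal to -1.\<close>
      with key[of "(y + 1) / (2 * (cmod z)\<^sup>2)" 1] \<open>z \<noteq> 0\<close> show False by simp
    qed
    then show ?thesis using x0 psd_mat_diag(2)[OF X jk(2)] by (simp add: y_def)
  next
    case False
    \<comment> \<open>The choice \<open>r = 1\<close>, \<open>s = x\<close> minimises the form up to
      scaling and leaves \<open>x\<close> times the minor.\<close>
    have "0 \<le> x * (x * y - (cmod z)\<^sup>2)" using key[of 1 x] by (simp add: algebra_simps power2_eq_square)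
    then show ?thesis using False x0 by (simp add: zero_le_mult_iff)
  qed
  then show ?thesis by (simp add: x_def y_def z_def)
qed

text \<open>In an eigenbasis of \<open>A - B\<close> the two matrices agree off the diagonal.\<close>
lemma psd_sqrt_unique:
  assumes A: "psd_mat n A" and B: "psd_mat n B" and sq: "A * A = B * B"
  shows "A = B"
proof -
  note A' = psd_matD[OF A] and B' = psd_matD[OF B]
  have "hermitian_mat n (A - B)"
    using A'(1) B'(1) by (intro hermitian_matI) (auto simp flip: psd_mat_cnj[OF A] psd_mat_cnj[OF B])
  then obtain U d where U: "unitary_mat n U"
    and D: "A - B = U * diag_of n (\<lambda>i. complex_of_real (d i)) * mat_adjoint U"
    using hermitian_spectral by blast
  note U' = unitary_matD[OF U]
  note Ua = mat_adjoint_carrier[OF U'(1)]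
  define P Q where "P = mat_adjoint U * A * U" and "Q = mat_adjoint U * B * U"
  have Ppsd: "psd_mat n P" using psd_mat_conj[OF A Ua] by (simp add: P_def)
  have Qpsd: "psd_mat n Q" using psd_mat_conj[OF B Ua] by (simp add: Q_def)
  note P = psd_matD(1)[OF Ppsd] and Q = psd_matD(1)[OF Qpsd]
  have "P - Q = mat_adjoint U * (A - B) * U"
    using A'(1) B'(1) U'(1) by (simp add: P_def Q_def mult_minus_distrib_mat[of _ n n _ n]
      minus_mult_distrib_mat[of _ n n _ _ n] mult_carrier_mat[of _ n n _ n])
  also have "\<dots> = diag_of n (\<lambda>i. complex_of_real (d i))"
    unfolding D by (rule unitary_conj_cancel(2)[OF U]) simp
  finally have PQ: "P - Q = diag_of n (\<lambda>i. complex_of_real (d i))" .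
  have "unitary_mat n (mat_adjoint U)" using U' by (simp add: unitary_mat_def)
  from unitary_conj_mult[OF this]
  have "P * P = mat_adjoint U * (A * A) * U" "Q * Q = mat_adjoint U * (B * B) * U"
    using A' B' by (simp_all add: P_def Q_def)
  then have PP: "P * P = Q * Q" by (simp add: sq)
  have off: "P $$ (i, j) = Q $$ (i, j)" if "i < n" "j < n" "i \<noteq> j" for i j
    using arg_cong[OF PQ, of "\<lambda>X. X $$ (i, j)"] that P Q by simp
  have square_diag: "(X * X) $$ (i, i) = X $$ (i, i) * X $$ (i, i) + (\<Sum>k\<in>{..<n} - {i}. X $$ (i, k) * X $$ (k, i))"
    if "X \<in> carrier_mat n n" "i < n" for X :: "complex mat" and i
    using that(2) unfolding index_mult_mat_sum[OF that(1) that(1) that(2) that(2)]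
    by (subst sum.remove[of _ i]) auto
  have "P $$ (i, i) = Q $$ (i, i)" if i: "i < n" for i
  proof -
    \<comment> \<open>Removing this common part from the diagonal of \<open>P * P = Q * Q\<close>
      leaves equal squares of nonnegative reals.\<close>
    have "(\<Sum>k\<in>{..<n} - {i}. P $$ (i, k) * P $$ (k, i)) = (\<Sum>k\<in>{..<n} - {i}. Q $$ (i, k) * Q $$ (k, i))"
      using i by (intro sum.cong refl) (auto simp: off)
    then have "P $$ (i, i) * P $$ (i, i) = Q $$ (i, i) * Q $$ (i, i)"
      using arg_cong[OF PP, of "\<lambda>X. X $$ (i, i)"] square_diag[OF P i] square_diag[OF Q i] by simp
    then have "(Re (P $$ (i, i)))\<^sup>2 = (Re (Q $$ (i, i)))\<^sup>2"
      using psd_mat_diag(1)[OF Ppsd i] psd_mat_diag(1)[OF Qpsd i] by (simp add: complex_eq_iff power2_eq_square)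
    then show ?thesis
      using psd_mat_diag[OF Ppsd i] psd_mat_diag[OF Qpsd i] by (simp add: complex_eq_iff power2_eq_iff_nonneg)
  qed
  then have "P $$ (i, j) = Q $$ (i, j)" if "i < n" "j < n" for i j
    using off that by (cases "i = j") auto
  then have "P = Q" using P Q by (intro eq_matI) auto
  then have "U * P * mat_adjoint U = U * Q * mat_adjoint U" by simp
  then show ?thesis
    using unitary_conj_cancel(1)[OF U A'(1)] unitary_conj_cancel(1)[OF U B'(1)]
    by (simp add: P_def Q_def)
qed

text \<open>Uniqueness of the square root turns the definite description into a check: any positive
  semidefinite candidate with the right square is the absolute value.\<close>

lemma mat_abs_eqI:
  assumes "psd_mat (dim_col A) B" "B * B = mat_adjoint A * A"
  shows "mat_abs A = B"
  unfolding mat_abs_def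
proof (rule the_equality)
  show "C = B" if "psd_mat (dim_col A) C \<and> C * C = mat_adjoint A * A" for C
    by (rule psd_sqrt_unique[of "dim_col A"]) (simp_all add: that assms)
qed (simp add: assms)

lemma mat_trace_comm:
  assumes "A \<in> carrier_mat n m" "B \<in> carrier_mat m n"
  shows "mat_trace (A * B) = mat_trace (B * A)"
proof -
  have "mat_trace (A * B) = (\<Sum>i<n. \<Sum>j<m. A $$ (i, j) * B $$ (j, i))"
    using assms(1) by (simp add: mat_trace_def index_mult_mat_sum[OF assms] del: index_mult_mat(1))
  also have "\<dots> = (\<Sum>j<m. \<Sum>i<n. A $$ (i, j) * B $$ (j, i))" by (rule sum.swap)
  also have "\<dots> = mat_trace (B * A)"
    using assms(2) by (simp add: mat_trace_def index_mult_mat_sum[OF assms(2,1)] mult.commute del: index_mult_mat(1))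
  finally show ?thesis .
qed

lemma mat_trace_unitary_conj:
  assumes U: "unitary_mat n U" and X: "X \<in> carrier_mat n n"
  shows "mat_trace (U * X * mat_adjoint U) = mat_trace X"
    "mat_trace (mat_adjoint U * X * U) = mat_trace X"
proof -
  note U' = unitary_matD[OF U]
  have "mat_trace (U * X * mat_adjoint U) = mat_trace (mat_adjoint U * (U * X))"
    using U' X by (intro mat_trace_comm[of _ n n]) (auto intro: mult_carrier_mat[of _ n n])
  also have "mat_adjoint U * (U * X) = X"
    using U' X by (subst assoc_mult_mat[of _ n n _ n _ n, symmetric]) auto
  finally show "mat_trace (U * X * mat_adjoint U) = mat_trace X" .
  have "mat_trace (mat_adjoint U * X * U) = mat_trace (U * (mat_adjoint U * X))"
    using U' X by (intro mat_trace_comm[of _ n n]) (auto intro: mult_carrier_mat[of _ n n])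
  also have "U * (mat_adjoint U * X) = X"
    using U' X by (subst assoc_mult_mat[of _ n n _ n _ n, symmetric]) auto
  finally show "mat_trace (mat_adjoint U * X * U) = mat_trace X" .
qed

text \<open>The quadratic form is a finite linear combination of entries and so commutes with the
  integral. Its integrand is pointwise real and nonnegative, hence so is the result.\<close>

lemma psd_mat_integral:
  assumes psd: "\<And>x. psd_mat n (F x)"
    and int: "\<And>i j. i < n \<Longrightarrow> j < n \<Longrightarrow> integrable M (\<lambda>x. F x $$ (i, j))"
  shows "psd_mat n (Matrix.mat n n (\<lambda>(i, j). \<integral>x. F x $$ (i, j) \<partial>M))" (is "psd_mat n ?I")
proof -
  have I: "?I \<in> carrier_mat n n" by simp
  have "hermitian_mat n ?I"
  proof (intro hermitian_matI I)
    fix i j assume ij: "i < n" "j < n"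
    have "cnj (\<integral>x. F x $$ (j, i) \<partial>M) = (\<integral>x. F x $$ (i, j) \<partial>M)"
      unfolding psd_mat_cnj[OF psd ij(2,1)] by simp
    then show "cnj (?I $$ (j, i)) = ?I $$ (i, j)" using ij by simp
  qed
  moreover have "(?I *\<^sub>v v) \<bullet>c v = (\<integral>x. of_real (Re ((F x *\<^sub>v v) \<bullet>c v)) \<partial>M)"
    if v: "v \<in> carrier_vec n" for v
  proof -
    have "(?I *\<^sub>v v) \<bullet>c v = (\<Sum>i<n. \<Sum>j<n. \<integral>x. F x $$ (i, j) * v $ j * cnj (v $ i) \<partial>M)"
      unfolding quadratic_form_eq_sum[OF I v] by (intro sum.cong refl) simp
    also have "\<dots> = (\<Sum>i<n. \<integral>x. (\<Sum>j<n. F x $$ (i, j) * v $ j * cnj (v $ i)) \<partial>M)"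
      by (intro sum.cong refl Bochner_Integration.integral_sum[symmetric]) (auto intro!: integrable_mult_left int)
    also have "\<dots> = (\<integral>x. (\<Sum>i<n. \<Sum>j<n. F x $$ (i, j) * v $ j * cnj (v $ i)) \<partial>M)"
      by (intro Bochner_Integration.integral_sum[symmetric] Bochner_Integration.integrable_sum) (auto intro!: integrable_mult_left int)
    also have "\<dots> = (\<integral>x. of_real (Re ((F x *\<^sub>v v) \<bullet>c v)) \<partial>M)"
      using psd_matD(3)[OF psd v]
      by (intro Bochner_Integration.integral_cong refl)
        (simp add: complex_eq_iff quadratic_form_eq_sum[OF psd_matD(1)[OF psd] v])
    finally show ?thesis .
  qed
  ultimately show ?thesis
    using I psd_matD(4)[OF psd] by (auto simp: psd_mat_def hermitian_mat_def)
qed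

section \<open>The random evolution as a channel\<close>

lemma diag_of_mult: "diag_of n f * diag_of n g = diag_of n (\<lambda>i. f i * g i)"
proof (rule eq_matI)
  fix i j assume "i < dim_row (diag_of n (\<lambda>i. f i * g i))" "j < dim_col (diag_of n (\<lambda>i. f i * g i))"
  then have ij: "i < n" "j < n" by auto
  have "(diag_of n f * diag_of n g) $$ (i, j) = (\<Sum>k<n. if k = i then f i * diag_of n g $$ (i, j) else 0)"
    unfolding index_mult_mat_sum[OF diag_of_carrier diag_of_carrier ij]
    by (intro sum.cong refl) (auto simp: ij)
  then show "(diag_of n f * diag_of n g) $$ (i, j) = diag_of n (\<lambda>i. f i * g i) $$ (i, j)"
    using ij by simp
qed auto

lemma index_diag_mult_diag:
  assumes X: "X \<in> carrier_mat n n" and ij: "i < n" "j < n"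
  shows "(diag_of n f * X * diag_of n g) $$ (i, j) = f i * X $$ (i, j) * g j"
proof -
  have "(diag_of n f * X * diag_of n g) $$ (i, j)
      = (\<Sum>k<n. \<Sum>l<n. if l = j then if k = i then f i * X $$ (i, j) * g j else 0 else 0)"
    unfolding index_mult_mat3[OF diag_of_carrier X diag_of_carrier ij]
    by (intro sum.cong refl) (auto simp: ij)
  also have "\<dots> = (\<Sum>k<n. if k = i then f i * X $$ (i, j) * g j else 0)"
    using ij by (intro sum.cong refl) simp
  finally show ?thesis using ij by simp
qed

lemma adjoint_diag_of: "mat_adjoint (diag_of n f) = diag_of n (\<lambda>i. cnj (f i))"
  by (intro eq_matI) auto

lemma index_diag_conj:
  assumes U: "U \<in> carrier_mat n n" and ij: "i < n" "j < n"
  shows "(U * diag_of n f * mat_adjoint U) $$ (i, j) = (\<Sum>l<n. U $$ (i, l) * f l * cnj (U $$ (j, l)))"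
proof -
  have "(U * diag_of n f * mat_adjoint U) $$ (i, j)
      = (\<Sum>k<n. \<Sum>l<n. if l = k then U $$ (i, k) * f k * cnj (U $$ (j, k)) else 0)"
    unfolding index_mult_mat3[OF U diag_of_carrier mat_adjoint_carrier[OF U] ij]
    using U ij by (intro sum.cong refl) auto
  also have "\<dots> = (\<Sum>l<n. U $$ (i, l) * f l * cnj (U $$ (j, l)))"
    by (intro sum.cong refl) simp
  finally show ?thesis .
qed

lemma diag_conj_carrier:
  "U \<in> carrier_mat n n \<Longrightarrow> U * diag_of n f * mat_adjoint U \<in> carrier_mat n n"
  by (intro mult_carrier_mat[of _ n n] mat_adjoint_carrier) auto

lemma smult_diag_conj:
  assumes U: "U \<in> carrier_mat n n"
  shows "c \<cdot>\<^sub>m (U * diag_of n f * mat_adjoint U) = U * diag_of n (\<lambda>i. c * f i) * mat_adjoint U"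
proof (rule eq_matI)
  fix i j assume "i < dim_row (U * diag_of n (\<lambda>i. c * f i) * mat_adjoint U)"
    "j < dim_col (U * diag_of n (\<lambda>i. c * f i) * mat_adjoint U)"
  then have ij: "i < n" "j < n" using U by auto
  have "(c \<cdot>\<^sub>m (U * diag_of n f * mat_adjoint U)) $$ (i, j) = c * (U * diag_of n f * mat_adjoint U) $$ (i, j)"
    using ij U by (intro index_smult_mat) auto
  also have "\<dots> = (U * diag_of n (\<lambda>i. c * f i) * mat_adjoint U) $$ (i, j)"
    unfolding index_diag_conj[OF U ij] by (simp add: sum_distrib_left mult_ac)
  finally show "(c \<cdot>\<^sub>m (U * diag_of n f * mat_adjoint U)) $$ (i, j)
    = (U * diag_of n (\<lambda>i. c * f i) * mat_adjoint U) $$ (i, j)" .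
qed auto

lemma pow_diag_conj:
  assumes U: "unitary_mat n U"
  shows "(U * diag_of n f * mat_adjoint U) ^\<^sub>m k = U * diag_of n (\<lambda>i. f i ^ k) * mat_adjoint U"
proof (induction k)
  case 0
  have "diag_of n (\<lambda>i. f i ^ 0) = 1\<^sub>m n" by (intro eq_matI) auto
  then show ?case using unitary_matD[OF U] by simp
next
  case (Suc k)
  then show ?case
    by (simp add: unitary_conj_mult[OF U diag_of_carrier diag_of_carrier] diag_of_mult mult.commute)
qed

text \<open>Each entry of the matrix power series is a fixed finite linear combination of scalar
  exponential series, so convergence is inherited termwise.\<close>

lemma mat_exp_diag_conj:
  assumes U: "unitary_mat n U"
  shows "mat_exp (U * diag_of n f * mat_adjoint U) = U * diag_of n (\<lambda>i. exp (f i)) * mat_adjoint U"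
proof (rule eq_matI)
  note U' = unitary_matD(1)[OF U]
  fix i j assume "i < dim_row (U * diag_of n (\<lambda>i. exp (f i)) * mat_adjoint U)"
    "j < dim_col (U * diag_of n (\<lambda>i. exp (f i)) * mat_adjoint U)"
  then have ij: "i < n" "j < n" using U' by auto
  have "(\<lambda>k. \<Sum>l<n. U $$ (i, l) * (f l ^ k /\<^sub>R fact k) * cnj (U $$ (j, l))) sums
      (\<Sum>l<n. U $$ (i, l) * exp (f l) * cnj (U $$ (j, l)))"
    by (intro sums_sum sums_mult sums_mult2 exp_converges)
  also have "(\<lambda>k. \<Sum>l<n. U $$ (i, l) * (f l ^ k /\<^sub>R fact k) * cnj (U $$ (j, l)))
      = (\<lambda>k. (U * diag_of n (\<lambda>i. f i ^ k) * mat_adjoint U) $$ (i, j) / of_nat (fact k))"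
    unfolding index_diag_conj[OF U' ij]
    by (intro ext) (simp add: sum_divide_distrib sum_distrib_left scaleR_conv_of_real divide_inverse mult_ac)
  finally have "(\<Sum>k. (U * diag_of n (\<lambda>i. f i ^ k) * mat_adjoint U) $$ (i, j) / of_nat (fact k))
      = (U * diag_of n (\<lambda>i. exp (f i)) * mat_adjoint U) $$ (i, j)"
    unfolding index_diag_conj[OF U' ij] by (rule sums_unique[symmetric])
  then show "mat_exp (U * diag_of n f * mat_adjoint U) $$ (i, j)
      = (U * diag_of n (\<lambda>i. exp (f i)) * mat_adjoint U) $$ (i, j)"
    using ij U' by (simp add: mat_exp_def pow_diag_conj[OF U] del: index_mult_mat(1))
qed (use unitary_matD(1)[OF U] in \<open>auto simp: mat_exp_def\<close>)

lemma mat_mult_linear_middle: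
  fixes A X Y B :: "complex mat"
  assumes A: "A \<in> carrier_mat n n" and X: "X \<in> carrier_mat n n" and Y: "Y \<in> carrier_mat n n"
    and B: "B \<in> carrier_mat n n"
  shows "A * (c \<cdot>\<^sub>m X + a \<cdot>\<^sub>m Y) * B = c \<cdot>\<^sub>m (A * X * B) + a \<cdot>\<^sub>m (A * Y * B)"
proof (rule eq_matI)
  fix i j assume "i < dim_row (c \<cdot>\<^sub>m (A * X * B) + a \<cdot>\<^sub>m (A * Y * B))"
    "j < dim_col (c \<cdot>\<^sub>m (A * X * B) + a \<cdot>\<^sub>m (A * Y * B))"
  then have ij: "i < n" "j < n" using A B by auto
  have S: "c \<cdot>\<^sub>m X + a \<cdot>\<^sub>m Y \<in> carrier_mat n n" using X Y by simp
  have "(A * (c \<cdot>\<^sub>m X + a \<cdot>\<^sub>m Y) * B) $$ (i, j)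
      = (\<Sum>k<n. \<Sum>l<n. c * (A $$ (i, k) * X $$ (k, l) * B $$ (l, j)) + a * (A $$ (i, k) * Y $$ (k, l) * B $$ (l, j)))"
    unfolding index_mult_mat3[OF A S B ij] using X Y
    by (intro sum.cong refl) (auto simp: algebra_simps)
  also have "\<dots> = c * (A * X * B) $$ (i, j) + a * (A * Y * B) $$ (i, j)"
    unfolding index_mult_mat3[OF A X B ij] index_mult_mat3[OF A Y B ij]
    by (simp add: sum.distrib sum_distrib_left)
  also have "\<dots> = (c \<cdot>\<^sub>m (A * X * B) + a \<cdot>\<^sub>m (A * Y * B)) $$ (i, j)"
    using ij A B by (simp del: index_mult_mat(1))
  finally show "(A * (c \<cdot>\<^sub>m X + a \<cdot>\<^sub>m Y) * B) $$ (i, j) = (c \<cdot>\<^sub>m (A * X * B) + a \<cdot>\<^sub>m (A * Y * B)) $$ (i, j)" .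
qed (use A B in auto)

text \<open>An index below \<open>k * n\<close> is a block number together with an offset. A sum
  against a row of a block diagonal matrix therefore runs over the offsets of one block
  only.\<close>

lemma sum_block:
  fixes f :: "nat \<Rightarrow> 'a::comm_monoid_add"
  assumes "p < k * n"
  shows "(\<Sum>r<k * n. if p div n = r div n then f r else 0) = (\<Sum>a<n. f (p div n * n + a))"
proof -
  have n: "n > 0" using assms by (cases n) auto
  have b: "p div n < k" using assms n by (simp add: less_mult_imp_div_less)
  have lt: "p div n * n + a < k * n" if "a < n" for a
  proof -
    have "p div n * n + a < (p div n + 1) * n" using that by simp
    also have "\<dots> \<le> k * n" using b by (intro mult_right_mono) auto
    finally show ?thesis .
  qed
  have "(\<Sum>r<k * n. if p div n = r div n then f r else 0) = (\<Sum>r | r < k * n \<and> p div n = r div n. f r)"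
    by (simp add: sum.inter_filter[symmetric])
  also have "\<dots> = (\<Sum>a<n. f (p div n * n + a))"
    by (rule sum.reindex_bij_witness[of _ "\<lambda>a. p div n * n + a" "\<lambda>r. r mod n"]) (use n lt in auto)
  finally show ?thesis .
qed

section \<open>The random evolution in a fixed eigenbasis\<close>

locale diagonal_random_evolution = prob_space M
  for M :: "'s measure" and T :: "'s \<Rightarrow> real" and n :: nat and H U :: "complex mat" and d :: "nat \<Rightarrow> real" +
  assumes T_rv [measurable]: "T \<in> borel_measurable M"
    and unitary: "unitary_mat n U"
    and H_eq: "H = U * diag_of n (\<lambda>i. complex_of_real (d i)) * mat_adjoint U"
begin

lemmas U = unitary_matD[OF unitary]

text \<open>Closed form of the evolution operator at time \<open>t\<close>. Its entries are finite
  sums of bounded exponentials, so integrability reduces to that of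
  \<open>exp (\<i> * \<omega> * T)\<close>.\<close>

definition propagator :: "real \<Rightarrow> complex mat" where
  "propagator t = U * diag_of n (\<lambda>i. exp (- \<i> * of_real (t * d i))) * mat_adjoint U"

lemma propagator_carrier: "propagator t \<in> carrier_mat n n"
  unfolding propagator_def by (rule diag_conj_carrier[OF U(1)])

lemma mat_exp_H:
  "mat_exp ((- \<i> * complex_of_real t) \<cdot>\<^sub>m H) = propagator t"
  "mat_exp ((\<i> * complex_of_real t) \<cdot>\<^sub>m H) = mat_adjoint (propagator t)"
  unfolding H_eq smult_diag_conj[OF U(1)] mat_exp_diag_conj[OF unitary] propagator_def
    adjoint_conj[OF U(1) diag_of_carrier] adjoint_diag_of
  by (simp_all add: exp_cnj mult_ac)

lemma integrable_exp: "integrable M (\<lambda>x. exp (\<i> * complex_of_real (\<omega> * T x)))"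
proof (rule integrable_const_bound[of _ 1])
  show "AE x in M. norm (exp (\<i> * complex_of_real (\<omega> * T x))) \<le> 1" by simp
qed measurable

lemma char_fun_0: "char_fun M T 0 = 1"
  by (simp add: char_fun_def prob_space)

lemma char_fun_minus: "char_fun M T (- \<omega>) = cnj (char_fun M T \<omega>)"
proof -
  have "exp (\<i> * complex_of_real (- \<omega> * T x)) = cnj (exp (\<i> * complex_of_real (\<omega> * T x)))" for x
    by (simp add: exp_cnj)
  then show ?thesis by (simp only: char_fun_def Bochner_Integration.integral_cnj)
qed

lemma norm_char_fun_le: "cmod (char_fun M T \<omega>) \<le> 1"
proof -
  have "cmod (char_fun M T \<omega>) \<le> (\<integral>x. cmod (exp (\<i> * complex_of_real (\<omega> * T x))) \<partial>M)"
    unfolding char_fun_def by (rule integral_norm_bound)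
  then show ?thesis by (simp add: prob_space)
qed

text \<open>In the eigenbasis the left factor contributes the phase of \<open>- t * d k\<close> and
  the right one that of \<open>t * d l\<close>. Time enters only through these scalars.\<close>

lemma index_propagator_conj:
  assumes X: "X \<in> carrier_mat n n" and ij: "i < n" "j < n"
  shows "(propagator t * X * mat_adjoint (propagator t)) $$ (i, j)
    = (\<Sum>k<n. \<Sum>l<n. U $$ (i, k) * (exp (\<i> * of_real ((d l - d k) * t)) * (mat_adjoint U * X * U) $$ (k, l)) * cnj (U $$ (j, l)))"
proof -
  define Y where "Y = mat_adjoint U * X * U"
  define D where "D = diag_of n (\<lambda>i. exp (- \<i> * of_real (t * d i)))"
  have D: "D \<in> carrier_mat n n" by (simp add: D_def)
  have Y: "Y \<in> carrier_mat n n"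
    unfolding Y_def using U(1) X by (intro mult_carrier_mat[of _ n n] mat_adjoint_carrier)
  have Z: "D * Y * mat_adjoint D \<in> carrier_mat n n"
    using D Y by (intro mult_carrier_mat[of _ n n] mat_adjoint_carrier)
  have "propagator t * X * mat_adjoint (propagator t)
      = (U * D * mat_adjoint U) * (U * Y * mat_adjoint U) * (U * mat_adjoint D * mat_adjoint U)"
    unfolding Y_def unitary_conj_cancel(1)[OF unitary X] propagator_def D_def
      adjoint_conj[OF U(1) diag_of_carrier] ..
  also have "\<dots> = U * (D * Y * mat_adjoint D) * mat_adjoint U"
    using D Y by (simp add: unitary_conj_mult[OF unitary] mult_carrier_mat[of _ n n])
  finally have eq: "propagator t * X * mat_adjoint (propagator t) = U * (D * Y * mat_adjoint D) * mat_adjoint U" .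
  have entry: "(D * Y * mat_adjoint D) $$ (k, l) = exp (\<i> * of_real ((d l - d k) * t)) * Y $$ (k, l)"
    if "k < n" "l < n" for k l
    unfolding D_def adjoint_diag_of index_diag_mult_diag[OF Y that]
    by (simp add: exp_cnj exp_add[symmetric] mult_ac algebra_simps flip: exp_minus)
  show ?thesis
    unfolding eq index_mult_mat3[OF U(1) Z mat_adjoint_carrier[OF U(1)] ij] Y_def[symmetric]
    using U(1) ij by (intro sum.cong refl) (simp add: entry del: index_mult_mat(1))
qed

lemma integrable_propagator_conj:
  assumes "X \<in> carrier_mat n n" "i < n" "j < n"
  shows "integrable M (\<lambda>x. (propagator (T x) * X * mat_adjoint (propagator (T x))) $$ (i, j))"
  unfolding index_propagator_conj[OF assms]
  by (intro Bochner_Integration.integrable_sum integrable_mult_left integrable_mult_right integrable_exp)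

abbreviation evolve :: "complex mat \<Rightarrow> complex mat" where
  "evolve \<equiv> random_evolution n H M T"

lemma evolve_carrier: "evolve X \<in> carrier_mat n n"
  by (simp add: random_evolution_def)

lemma index_evolve:
  "i < n \<Longrightarrow> j < n \<Longrightarrow>
    evolve X $$ (i, j) = (\<integral>x. (propagator (T x) * X * mat_adjoint (propagator (T x))) $$ (i, j) \<partial>M)"
  unfolding random_evolution_def mat_exp_H by (simp del: index_mult_mat(1))

text \<open>Schur multiplication, that is, the entrywise product with the matrix of values of the
  characteristic function.\<close>

definition dephase :: "complex mat \<Rightarrow> complex mat" where
  "dephase Y = Matrix.mat n n (\<lambda>(k, l). char_fun M T (d l - d k) * Y $$ (k, l))"

lemma dephase_carrier: "dephase Y \<in> carrier_mat n n"
  by (simp add: dephase_def)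

lemma evolve_eq:
  assumes X: "X \<in> carrier_mat n n"
  shows "evolve X = U * dephase (mat_adjoint U * X * U) * mat_adjoint U"
proof (rule eq_matI)
  fix i j assume "i < dim_row (U * dephase (mat_adjoint U * X * U) * mat_adjoint U)"
    "j < dim_col (U * dephase (mat_adjoint U * X * U) * mat_adjoint U)"
  then have ij: "i < n" "j < n" using U(1) by auto
  define Y where "Y = mat_adjoint U * X * U"
  \<comment> \<open>The integral passes through both finite sums and meets only the scalar phase,
    whose mean is the characteristic function.\<close>
  have "evolve X $$ (i, j) = (\<Sum>k<n. \<Sum>l<n. U $$ (i, k) * (char_fun M T (d l - d k) * Y $$ (k, l)) * cnj (U $$ (j, l)))"
    unfolding index_evolve[OF ij] index_propagator_conj[OF X ij] char_fun_def Y_def[symmetric]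
    by (subst Bochner_Integration.integral_sum,
        intro Bochner_Integration.integrable_sum integrable_mult_left integrable_mult_right integrable_exp,
        intro sum.cong refl, subst Bochner_Integration.integral_sum,
        intro integrable_mult_left integrable_mult_right integrable_exp,
        intro sum.cong refl, simp)
  also have "\<dots> = (U * dephase Y * mat_adjoint U) $$ (i, j)"
    unfolding index_mult_mat3[OF U(1) dephase_carrier mat_adjoint_carrier[OF U(1)] ij]
    using U(1) ij by (intro sum.cong refl) (simp add: dephase_def)
  finally show "evolve X $$ (i, j) = (U * dephase (mat_adjoint U * X * U) * mat_adjoint U) $$ (i, j)"
    unfolding Y_def .
qed (use U(1) evolve_carrier[of X] in auto)

lemma evolve_linear:
  assumes X: "X \<in> carrier_mat n n" and Y: "Y \<in> carrier_mat n n"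
  shows "evolve (c \<cdot>\<^sub>m X + a \<cdot>\<^sub>m Y) = c \<cdot>\<^sub>m evolve X + a \<cdot>\<^sub>m evolve Y"
proof -
  note Ua = mat_adjoint_carrier[OF U(1)]
  have S: "c \<cdot>\<^sub>m X + a \<cdot>\<^sub>m Y \<in> carrier_mat n n" using X Y by simp
  have "dephase (c \<cdot>\<^sub>m P + a \<cdot>\<^sub>m Q) = c \<cdot>\<^sub>m dephase P + a \<cdot>\<^sub>m dephase Q"
    if "P \<in> carrier_mat n n" "Q \<in> carrier_mat n n" for P Q
    using that by (intro eq_matI) (auto simp: dephase_def algebra_simps)
  moreover have "mat_adjoint U * X * U \<in> carrier_mat n n" "mat_adjoint U * Y * U \<in> carrier_mat n n"
    using U(1) X Y by (auto intro!: mult_carrier_mat[of _ n n])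
  ultimately show ?thesis
    unfolding evolve_eq[OF X] evolve_eq[OF Y] evolve_eq[OF S] mat_mult_linear_middle[OF Ua X Y U(1)]
    by (simp add: mat_mult_linear_middle[OF U(1) dephase_carrier dephase_carrier Ua])
qed

text \<open>The diagonal multipliers are \<Phi>(0) = 1.\<close>

lemma trace_evolve:
  assumes X: "X \<in> carrier_mat n n"
  shows "mat_trace (evolve X) = mat_trace X"
proof -
  define Y where "Y = mat_adjoint U * X * U"
  have Y: "Y \<in> carrier_mat n n"
    unfolding Y_def using U(1) X by (intro mult_carrier_mat[of _ n n] mat_adjoint_carrier)
  have "mat_trace (evolve X) = mat_trace (dephase Y)"
    unfolding evolve_eq[OF X] Y_def by (rule mat_trace_unitary_conj(1)[OF unitary dephase_carrier])
  also have "\<dots> = mat_trace Y" using Y by (simp add: mat_trace_def dephase_def char_fun_0)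
  also have "\<dots> = mat_trace X" unfolding Y_def by (rule mat_trace_unitary_conj(2)[OF unitary X])
  finally show ?thesis .
qed

text \<open>Pointwise in the sample space, the ampliated channel is conjugation by the block diagonal
  matrix \<open>1 \<otimes> propagator (T x)\<close>.\<close>
lemma psd_ampliate_evolve:
  assumes X: "psd_mat (k * n) X"
  shows "psd_mat (k * n) (ampliate k n evolve X)"
proof -
  note X' = psd_matD(1)[OF X]
  define B where "B t = Matrix.mat (k * n) (k * n)
    (\<lambda>(p, q). if p div n = q div n then propagator t $$ (p mod n, q mod n) else 0)" for t
  have B: "B t \<in> carrier_mat (k * n) (k * n)" for t by (simp add: B_def)
  have Bindex: "B t $$ (p, q) = (if p div n = q div n then propagator t $$ (p mod n, q mod n) else 0)"
    if "p < k * n" "q < k * n" for t p q using that by (simp add: B_def)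
  have blk: "block_of n X a b \<in> carrier_mat n n" for a b by (simp add: block_of_def)
  \<comment> \<open>Conjugation by a block diagonal matrix with equal blocks acts on each block of
    \<open>X\<close> separately, which is exactly how \<open>ampliate\<close> applies a map.\<close>
  have entry: "(B t * X * mat_adjoint (B t)) $$ (p, q)
      = (propagator t * block_of n X (p div n) (q div n) * mat_adjoint (propagator t)) $$ (p mod n, q mod n)"
    if p: "p < k * n" and q: "q < k * n" for t p q
  proof -
    have n: "n > 0" using p by (cases n) auto
    then have mn: "p mod n < n" "q mod n < n" by auto
    let ?g = "\<lambda>r s. propagator t $$ (p mod n, r mod n) * X $$ (r, s) * cnj (propagator t $$ (q mod n, s mod n))"
    have "(B t * X * mat_adjoint (B t)) $$ (p, q) = (\<Sum>r<k * n. if p div n = r div n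
        then \<Sum>s<k * n. if q div n = s div n then ?g r s else 0 else 0)"
      unfolding index_mult_mat3[OF B X' mat_adjoint_carrier[OF B] p q]
      using B[of t] p q by (intro sum.cong refl) (auto simp: Bindex intro!: sum.cong)
    also have "\<dots> = (\<Sum>a<n. \<Sum>b<n. ?g (p div n * n + a) (q div n * n + b))"
      unfolding sum_block[OF p] sum_block[OF q] ..
    also have "\<dots> = (propagator t * block_of n X (p div n) (q div n) * mat_adjoint (propagator t)) $$ (p mod n, q mod n)"
      unfolding index_mult_mat3[OF propagator_carrier blk mat_adjoint_carrier[OF propagator_carrier] mn]
      using propagator_carrier[of t] mn by (intro sum.cong refl) (auto simp: block_of_def)
    finally show ?thesis .
  qed
  have "psd_mat (k * n) (Matrix.mat (k * n) (k * n) (\<lambda>(p, q). \<integral>x. (B (T x) * X * mat_adjoint (B (T x))) $$ (p, q) \<partial>M))"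
  proof (rule psd_mat_integral)
    show "psd_mat (k * n) (B (T x) * X * mat_adjoint (B (T x)))" for x
      by (rule psd_mat_conj[OF X B])
    fix p q assume pq: "p < k * n" "q < k * n"
    \<comment> \<open>Positivity of \<open>n\<close> is what makes \<open>p mod n\<close> and
      \<open>q mod n\<close> valid indices inside a block.\<close>
    then have "n > 0" by (cases n) auto
    then show "integrable M (\<lambda>x. (B (T x) * X * mat_adjoint (B (T x))) $$ (p, q))"
      unfolding entry[OF pq] by (intro integrable_propagator_conj blk) auto
  qed
  also have "Matrix.mat (k * n) (k * n) (\<lambda>(p, q). \<integral>x. (B (T x) * X * mat_adjoint (B (T x))) $$ (p, q) \<partial>M)
      = ampliate k n evolve X"
  proof (rule eq_matI)
    fix p q assume "p < dim_row (ampliate k n evolve X)" "q < dim_col (ampliate k n evolve X)"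
    then have pq: "p < k * n" "q < k * n" by (auto simp: ampliate_def)
    then have "n > 0" by (cases n) auto
    then show "Matrix.mat (k * n) (k * n) (\<lambda>(p, q). \<integral>x. (B (T x) * X * mat_adjoint (B (T x))) $$ (p, q) \<partial>M) $$ (p, q)
      = ampliate k n evolve X $$ (p, q)"
      using pq by (simp add: ampliate_def entry index_evolve del: index_mult_mat(1))
  qed (auto simp: ampliate_def)
  finally show ?thesis .
qed

lemma quantum_operation_evolve: "quantum_operation n evolve"
  using evolve_carrier evolve_linear trace_evolve psd_ampliate_evolve
  by (simp add: quantum_operation_def)

end

section \<open>Trace norm of the cross terms\<close>

text \<open>The absolute value of \<open>G = w e\<^sub>k\<^sup>* + e\<^sub>k w\<^sup>*\<close> with \<open>w\<close> orthogonal to \<open>e\<^sub>k\<close> and \<open>s = norm w\<close> is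
  \<open>s e\<^sub>k e\<^sub>k\<^sup>* + w w\<^sup>* / s\<close>; for \<open>s = 0\<close> the junk value of the quotient is harmless, as then \<open>w = 0\<close>.\<close>
lemma trace_norm_cross:
  fixes w :: "nat \<Rightarrow> complex"
  assumes U: "unitary_mat n U" and k: "k < n" and wk: "w k = 0"
  defines "G \<equiv> Matrix.mat n n (\<lambda>(i, j). (if j = k then w i else 0) + (if i = k then cnj (w j) else 0))"
  shows "trace_norm (U * G * mat_adjoint U) = 2 * sqrt (\<Sum>i<n. (cmod (w i))\<^sup>2)"
proof -
  define s where "s = sqrt (\<Sum>i<n. (cmod (w i))\<^sup>2)"
  have s0: "0 \<le> s" by (simp add: s_def sum_nonneg)
  have s2: "(\<Sum>l<n. cnj (w l) * w l) = of_real (s\<^sup>2)"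
    by (simp add: s_def sum_nonneg mult.commute flip: complex_norm_square)
  have w0: "w i = 0" if "s = 0" "i < n" for i
    using that by (simp add: s_def sum_nonneg_eq_0_iff)
  define R where "R = Matrix.mat n n (\<lambda>(i, j). (if i = k \<and> j = k then of_real s else 0) + w i * cnj (w j) / of_real s)"
  have G: "G \<in> carrier_mat n n" and R: "R \<in> carrier_mat n n" by (simp_all add: G_def R_def)
  have Gh: "mat_adjoint G = G" by (intro eq_matI) (auto simp: G_def)
  have GG: "(G * G) $$ (i, j) = w i * cnj (w j) + (if i = k \<and> j = k then of_real (s\<^sup>2) else 0)"
    if ij: "i < n" "j < n" for i j
  proof -
    have "(G * G) $$ (i, j) = (\<Sum>l<n. (if l = k then w i * cnj (w j) else 0)
        + (if i = k \<and> j = k then cnj (w l) * w l else 0))"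
      unfolding index_mult_mat_sum[OF G G ij] using ij k wk
      by (intro sum.cong refl) (auto simp: G_def)
    then show ?thesis using k by (cases "i = k \<and> j = k") (auto simp: sum.distrib s2)
  qed
  have RR: "(R * R) $$ (i, j) = w i * cnj (w j) + (if i = k \<and> j = k then of_real (s\<^sup>2) else 0)"
    if ij: "i < n" "j < n" for i j
  proof -
    \<comment> \<open>Since \<open>w k = 0\<close>, the two rank-one parts of \<open>R\<close>
      annihilate each other and only their squares remain.\<close>
    have "(R * R) $$ (i, j) = (\<Sum>l<n. (if l = k then if i = k \<and> j = k then of_real (s\<^sup>2) else 0 else 0)
        + w i * cnj (w j) / of_real (s\<^sup>2) * (cnj (w l) * w l))"
      unfolding index_mult_mat_sum[OF R R ij] using ij k wk
      by (intro sum.cong refl) (auto simp: R_def power2_eq_square)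
    also have "\<dots> = (if i = k \<and> j = k then of_real (s\<^sup>2) else 0) + w i * cnj (w j) / of_real (s\<^sup>2) * of_real (s\<^sup>2)"
      using k by (simp only: sum.distrib s2 sum_distrib_left[symmetric]) simp
    \<comment> \<open>For \<open>s = 0\<close> the quotient is 0, and \<open>w i = 0\<close> makes
      the expected term vanish too.\<close>
    finally show ?thesis using w0 ij by (cases "s = 0") auto
  qed
  have "R * R = G * G"
    using R G by (intro eq_matI) (auto simp: GG RR simp del: index_mult_mat(1))
  have "psd_mat n R"
    unfolding psd_mat_def
  proof (intro conjI ballI)
    show "hermitian_mat n R"
      by (intro hermitian_matI R) (auto simp: R_def)
    fix v :: "complex Matrix.vec" assume v: "v \<in> carrier_vec n"
    \<comment> \<open>The inner product of \<open>v\<close> with \<open>w\<close>: the rank-one part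
      of \<open>R\<close> contributes its squared modulus divided by \<open>s\<close>.\<close>
    define z where "z = (\<Sum>j<n. cnj (w j) * v $ j)"
    have "(R *\<^sub>v v) \<bullet>c v = (\<Sum>i<n. \<Sum>j<n. (if j = k then if i = k then of_real s * (v $ k * cnj (v $ k)) else 0 else 0)
        + (w i * cnj (v $ i)) * (cnj (w j) * v $ j) / of_real s)"
      unfolding quadratic_form_eq_sum[OF R v]
      by (intro sum.cong refl) (auto simp: R_def algebra_simps)
    also have "\<dots> = of_real s * (v $ k * cnj (v $ k)) + (\<Sum>i<n. w i * cnj (v $ i)) * z / of_real s"
      using k by (simp add: sum.distrib z_def sum_product sum_divide_distrib)
    also have "(\<Sum>i<n. w i * cnj (v $ i)) = cnj z" by (simp add: z_def)
    also have "of_real s * (v $ k * cnj (v $ k)) + cnj z * z / of_real s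
        = of_real (s * (cmod (v $ k))\<^sup>2 + (cmod z)\<^sup>2 / s)"
      by (simp add: mult.commute[of "cnj z"] flip: complex_norm_square)
    finally have form: "(R *\<^sub>v v) \<bullet>c v = of_real (s * (cmod (v $ k))\<^sup>2 + (cmod z)\<^sup>2 / s)" .
    show "Im ((R *\<^sub>v v) \<bullet>c v) = 0" unfolding form by simp
    show "0 \<le> Re ((R *\<^sub>v v) \<bullet>c v)" unfolding form using s0 by simp
  qed
  then have "psd_mat n (U * R * mat_adjoint U)"
    by (rule psd_mat_conj[OF _ unitary_matD(1)[OF U]])
  moreover have "(U * R * mat_adjoint U) * (U * R * mat_adjoint U)
      = mat_adjoint (U * G * mat_adjoint U) * (U * G * mat_adjoint U)"
    unfolding adjoint_conj[OF unitary_matD(1)[OF U] G] Gh unitary_conj_mult[OF U G G]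
      unitary_conj_mult[OF U R R] \<open>R * R = G * G\<close> ..
  ultimately have "mat_abs (U * G * mat_adjoint U) = U * R * mat_adjoint U"
    using unitary_matD(1)[OF U] by (intro mat_abs_eqI) auto
  then have "trace_norm (U * G * mat_adjoint U) = Re (mat_trace R)"
    by (simp add: trace_norm_def mat_trace_unitary_conj(1)[OF U R])
  also have "mat_trace R = (\<Sum>i<n. (if i = k then of_real s else 0) + cnj (w i) * w i / of_real s)"
    using R by (auto simp: mat_trace_def R_def intro!: sum.cong)
  also have "\<dots> = of_real s + of_real (s\<^sup>2) / of_real s"
    using k by (simp add: sum.distrib s2 flip: sum_divide_distrib)
  \<comment> \<open>Both parts of \<open>R\<close> have trace \<open>s\<close>; this includes
    \<open>s = 0\<close>, where the quotient is 0.\<close>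
  also have "\<dots> = of_real (2 * s)" by (simp add: power2_eq_square)
  finally show ?thesis by (simp add: s_def)
qed

text \<open>The minors give \<open>(cmod (X $$ (j, k)))\<^sup>2 \<le> Re (X $$ (j, j)) * p\<close>,
  and the diagonal entries other than \<open>p\<close> add up to \<open>1 - p\<close>.\<close>

lemma density_column_bound:
  assumes X: "psd_mat n X" and tr: "mat_trace X = 1" and k: "k < n"
  shows "(\<Sum>j\<in>{..<n} - {k}. (cmod (X $$ (j, k)))\<^sup>2) \<le> 1 / 4"
proof -
  define p where "p = Re (X $$ (k, k))"
  have "(\<Sum>j<n. Re (X $$ (j, j))) = 1"
    using arg_cong[OF tr, of Re] psd_matD(1)[OF X] by (simp add: mat_trace_def)
  then have "(\<Sum>j\<in>{..<n} - {k}. Re (X $$ (j, j))) = 1 - p"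
    using k by (subst (asm) sum.remove[of _ k]) (auto simp: p_def)
  then have "(\<Sum>j\<in>{..<n} - {k}. Re (X $$ (j, j)) * p) = (1 - p) * p"
    by (simp flip: sum_distrib_right)
  moreover have "(\<Sum>j\<in>{..<n} - {k}. (cmod (X $$ (j, k)))\<^sup>2) \<le> (\<Sum>j\<in>{..<n} - {k}. Re (X $$ (j, j)) * p)"
    unfolding p_def using psd_mat_minor[OF X _ k] by (intro sum_mono) auto
  moreover have "(1 - p) * p \<le> 1 / 4"
    using zero_le_power2[of "p - 1 / 2"] by (simp add: power2_eq_square algebra_simps)
  ultimately show ?thesis by linarith
qed

text \<open>The adjoint of \<open>U\<close> sends column \<open>j\<close> to a unit vector, which
  the diagonal matrix only scales. These columns witness which \<open>d j\<close> are eigenvalues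
  and are the vectors to which nondegeneracy is applied.\<close>

lemma unitary_diag_eigenvector:
  assumes U: "unitary_mat n U" and j: "j < n"
  shows "(U * diag_of n f * mat_adjoint U) *\<^sub>v col U j = f j \<cdot>\<^sub>v col U j"
    and "col U j \<in> carrier_vec n" and "col U j \<noteq> 0\<^sub>v n"
proof -
  note U' = unitary_matD[OF U]
  show c: "col U j \<in> carrier_vec n" using U' by (auto intro: carrier_vecI)
  have e: "mat_adjoint U *\<^sub>v col U j = unit_vec n j"
    using col_mult2[OF mat_adjoint_carrier[OF U'(1)] U'(1) j] j by (simp add: U'(2))
  show "col U j \<noteq> 0\<^sub>v n"
  proof
    assume "col U j = 0\<^sub>v n"
    from arg_cong[OF e[unfolded this], of "\<lambda>v. v $ j"] show False using U'(1) j by simp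
  qed
  have "(U * diag_of n f * mat_adjoint U) *\<^sub>v col U j = U *\<^sub>v (diag_of n f *\<^sub>v unit_vec n j)"
    using U'(1) c by (simp add: e[symmetric] assoc_mult_mat_vec[of _ n n _ n] mult_carrier_mat[of _ n n _ n] mult_mat_vec_carrier[of _ n n])
  also have "diag_of n f *\<^sub>v unit_vec n j = f j \<cdot>\<^sub>v unit_vec n j"
    using j by (intro eq_vecI) auto
  also have "U *\<^sub>v (f j \<cdot>\<^sub>v unit_vec n j) = f j \<cdot>\<^sub>v (U *\<^sub>v unit_vec n j)"
    by (rule mult_mat_vec[OF U'(1)]) simp
  also have "U *\<^sub>v unit_vec n j = col U j"
    using U'(1) j by (intro eq_vecI) auto
  finally show "(U * diag_of n f * mat_adjoint U) *\<^sub>v col U j = f j \<cdot>\<^sub>v col U j" .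
qed

text \<open>The coordinates \<open>z\<close> of \<psi> in the eigenbasis satisfy
  \<open>d i * z $ i = E * z $ i\<close>, so a nonzero coordinate selects an index \<open>k\<close>
  with \<open>d k = E\<close>. Nondegeneracy then makes column \<open>k\<close> a multiple of
  \<psi>.\<close>

lemma nondegenerate_eigenvector_column:
  assumes U: "unitary_mat n U"
    and H: "H = U * diag_of n (\<lambda>i. complex_of_real (d i)) * mat_adjoint U"
    and \<psi>: "\<psi> \<in> carrier_vec n" "\<psi> \<bullet>c \<psi> = 1" "H *\<^sub>v \<psi> = complex_of_real E \<cdot>\<^sub>v \<psi>"
    and nondeg: "\<forall>v \<in> carrier_vec n. H *\<^sub>v v = complex_of_real E \<cdot>\<^sub>v v \<longrightarrow> (\<exists>c. v = c \<cdot>\<^sub>v \<psi>)"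
  shows "\<exists>k<n. d k = E \<and> (\<forall>j<n. j \<noteq> k \<longrightarrow> d j \<noteq> E) \<and>
    proj \<psi> = U * diag_of n (\<lambda>i. if i = k then 1 else 0) * mat_adjoint U"
proof -
  note U' = unitary_matD[OF U]
  note Ua = mat_adjoint_carrier[OF U'(1)]
  define z where "z = mat_adjoint U *\<^sub>v \<psi>"
  have z: "z \<in> carrier_vec n" unfolding z_def by (rule mult_mat_vec_carrier[OF Ua \<psi>(1)])
  have Uz: "U *\<^sub>v z = \<psi>"
    unfolding z_def using assoc_mult_mat_vec[OF U'(1) Ua \<psi>(1)] \<psi>(1) by (simp add: U'(3))
  have "diag_of n (\<lambda>i. complex_of_real (d i)) *\<^sub>v z = mat_adjoint U *\<^sub>v (H *\<^sub>v \<psi>)"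
  proof -
    have "H *\<^sub>v \<psi> = U *\<^sub>v (diag_of n (\<lambda>i. complex_of_real (d i)) *\<^sub>v z)"
      unfolding H z_def using U'(1) \<psi>(1)
      by (simp add: assoc_mult_mat_vec[of _ n n _ n] mult_carrier_mat[of _ n n _ n] mult_mat_vec_carrier[of _ n n])
    then show ?thesis
      using assoc_mult_mat_vec[OF Ua U'(1) mult_mat_vec_carrier[OF diag_of_carrier z]]
        mult_mat_vec_carrier[OF diag_of_carrier z] by (simp add: U'(2))
  qed
  also have "\<dots> = complex_of_real E \<cdot>\<^sub>v z"
    unfolding \<psi>(3) z_def by (rule mult_mat_vec[OF Ua \<psi>(1)])
  finally have Dz: "diag_of n (\<lambda>i. complex_of_real (d i)) *\<^sub>v z = complex_of_real E \<cdot>\<^sub>v z" .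
  have dz: "complex_of_real (d i) * z $ i = complex_of_real E * z $ i" if i: "i < n" for i
  proof -
    have "(diag_of n (\<lambda>i. complex_of_real (d i)) *\<^sub>v z) $ i
        = (\<Sum>j<n. if j = i then complex_of_real (d i) * z $ i else 0)"
      unfolding index_mult_mat_vec_sum[OF diag_of_carrier z i] using i by (intro sum.cong refl) auto
    then show ?thesis unfolding Dz using i z by auto
  qed
  have "\<exists>k<n. z $ k \<noteq> 0"
  proof (rule ccontr)
    assume "\<not> (\<exists>k<n. z $ k \<noteq> 0)"
    then have "z = 0\<^sub>v n" using z by (intro eq_vecI) auto
    then have "\<psi> = 0\<^sub>v n" using Uz U'(1) by auto
    then show False using \<psi>(2) by simp
  qed
  then obtain k where k: "k < n" "z $ k \<noteq> 0" by blast
  have dk: "d k = E" using dz[OF k(1)] k(2) by simp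
  have multiple: "\<exists>c. c \<noteq> 0 \<and> col U j = c \<cdot>\<^sub>v \<psi>" if j: "j < n" "d j = E" for j
  proof -
    obtain c where c: "col U j = c \<cdot>\<^sub>v \<psi>"
      using nondeg unitary_diag_eigenvector(1)[OF U j(1), of "\<lambda>i. complex_of_real (d i)"]
        unitary_diag_eigenvector(2)[OF U j(1)] j(2) H by auto
    moreover have "c \<noteq> 0"
    proof
      assume "c = 0"
      with c have "col U j = 0\<^sub>v n" using \<psi>(1) by auto
      with unitary_diag_eigenvector(3)[OF U j(1)] show False by simp
    qed
    ultimately show ?thesis by blast
  qed
  have \<psi>\<psi>: "(\<Sum>i<n. cnj (\<psi> $ i) * \<psi> $ i) = 1"
    using \<psi>(2) unfolding cscalar_prod_sum[OF \<psi>(1)] by (simp add: mult.commute)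
  have inner: "(if i = j then 1 else 0) = cnj a * b"
    if "i < n" "j < n" "col U i = a \<cdot>\<^sub>v \<psi>" "col U j = b \<cdot>\<^sub>v \<psi>" for i j a b
  proof -
    have "U $$ (l, i) = a * \<psi> $ l" "U $$ (l, j) = b * \<psi> $ l" if "l < n" for l
      using arg_cong[OF \<open>col U i = a \<cdot>\<^sub>v \<psi>\<close>, of "\<lambda>v. v $ l"] arg_cong[OF \<open>col U j = b \<cdot>\<^sub>v \<psi>\<close>, of "\<lambda>v. v $ l"]
        \<open>i < n\<close> \<open>j < n\<close> that U'(1) \<psi>(1) by auto
    then have "(mat_adjoint U * U) $$ (i, j) = (\<Sum>l<n. cnj a * b * (cnj (\<psi> $ l) * \<psi> $ l))"
      unfolding index_mult_mat_sum[OF Ua U'(1) that(1,2)] using U'(1) that(1,2)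
      by (intro sum.cong refl) simp
    then show ?thesis using that(1,2) by (simp add: U'(2) \<psi>\<psi> flip: sum_distrib_left)
  qed
  obtain a where a: "a \<noteq> 0" "col U k = a \<cdot>\<^sub>v \<psi>" using multiple[OF k(1) dk] by blast
  have aa: "a * cnj a = 1" using inner[OF k(1) k(1) a(2) a(2)] by (simp add: mult.commute)
  \<comment> \<open>A second column with eigenvalue \<open>E\<close> would also be a nonzero
    multiple of \<psi>, hence not orthogonal to column \<open>k\<close>.\<close>
  have uniq: "d j \<noteq> E" if "j < n" "j \<noteq> k" for j
    using multiple[OF that(1)] inner[OF that(1) k(1) _ a(2)] a(1) that(2) by fastforce
  have "proj \<psi> = U * diag_of n (\<lambda>i. if i = k then 1 else 0) * mat_adjoint U"
  proof (rule eq_matI)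
    fix i j assume "i < dim_row (U * diag_of n (\<lambda>i. if i = k then 1 else 0) * mat_adjoint U)"
      "j < dim_col (U * diag_of n (\<lambda>i. if i = k then 1 else 0) * mat_adjoint U)"
    then have ij: "i < n" "j < n" using U'(1) by auto
    have Uk: "U $$ (l, k) = a * \<psi> $ l" if "l < n" for l
      using arg_cong[OF a(2), of "\<lambda>v. v $ l"] k(1) that U'(1) \<psi>(1) by auto
    have "(U * diag_of n (\<lambda>i. if i = k then 1 else 0) * mat_adjoint U) $$ (i, j)
        = (\<Sum>l<n. if l = k then U $$ (i, k) * cnj (U $$ (j, k)) else 0)"
      unfolding index_diag_conj[OF U'(1) ij] by (intro sum.cong refl) auto
    \<comment> \<open>Column \<open>k\<close> and \<psi> differ by a phase \<open>a\<close>, which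
      has modulus one and drops out of the projector.\<close>
    also have "\<dots> = (a * cnj a) * (\<psi> $ i * cnj (\<psi> $ j))"
      using k(1) by (simp add: Uk ij)
    finally show "proj \<psi> $$ (i, j) = (U * diag_of n (\<lambda>i. if i = k then 1 else 0) * mat_adjoint U) $$ (i, j)"
      using ij \<psi>(1) by (simp add: aa proj_def del: index_mult_mat(1))
  qed (use U'(1) \<psi>(1) in \<open>auto simp: proj_def\<close>)
  then show ?thesis using k(1) dk uniq by blast
qed

section \<open>Comparison of the two maps in the eigenbasis\<close>

context diagonal_random_evolution
begin

text \<open>In the eigenbasis the projectors are 0/1 masks and commute with Schur multiplication.
  The entry \<open>(k, k)\<close> cancels because \<Phi>(0) = 1, the complementary block cancels
  identically, and the measurement kills the cross entries that the evolution keeps.\<close>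

lemma measure_map_minus_evolve:
  assumes X: "X \<in> carrier_mat n n" and k: "k < n"
    and P: "P = U * diag_of n (\<lambda>i. if i = k then 1 else 0) * mat_adjoint U"
  defines "Y \<equiv> mat_adjoint U * X * U"
  shows "measure_map n P evolve X - evolve X = U * Matrix.mat n n (\<lambda>(i, j).
    if (i = k) = (j = k) then 0 else - (char_fun M T (d j - d i) * Y $$ (i, j))) * mat_adjoint U"
proof -
  note Ua = mat_adjoint_carrier[OF U(1)]
  define p q where "p = diag_of n (\<lambda>i. if i = k then 1 else 0)" and "q = diag_of n (\<lambda>i. if i = k then 0 else 1)"
  have p: "p \<in> carrier_mat n n" and q: "q \<in> carrier_mat n n" by (simp_all add: p_def q_def)
  have Y: "Y \<in> carrier_mat n n"
    unfolding Y_def using U(1) X by (intro mult_carrier_mat[of _ n n] mat_adjoint_carrier)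
  have XY: "X = U * Y * mat_adjoint U" unfolding Y_def by (rule unitary_conj_cancel(1)[OF unitary X, symmetric])
  have conj_carrier: "U * Z * mat_adjoint U \<in> carrier_mat n n" if "Z \<in> carrier_mat n n" for Z
    using that U(1) by (intro mult_carrier_mat[of _ n n] mat_adjoint_carrier)
  have conj_add: "U * Z * mat_adjoint U + U * W * mat_adjoint U = U * (Z + W) * mat_adjoint U"
    and conj_minus: "U * Z * mat_adjoint U - U * W * mat_adjoint U = U * (Z - W) * mat_adjoint U"
    if "Z \<in> carrier_mat n n" "W \<in> carrier_mat n n" for Z W
    using that U(1) by (simp_all add: mult_add_distrib_mat[of _ n n _ n] add_mult_distrib_mat[of _ n n _ _ n]
      mult_minus_distrib_mat[of _ n n _ n] minus_mult_distrib_mat[of _ n n _ _ n] mult_carrier_mat[of _ n n _ n])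
  have "1\<^sub>m n = U * 1\<^sub>m n * mat_adjoint U" using U by simp
  then have "1\<^sub>m n - P = U * (1\<^sub>m n - p) * mat_adjoint U"
    unfolding P p_def[symmetric] using conj_minus[of "1\<^sub>m n" p] p by simp
  also have "1\<^sub>m n - p = q" by (intro eq_matI) (auto simp: p_def q_def)
  finally have Q: "1\<^sub>m n - P = U * q * mat_adjoint U" .
  have Z: "p * Y * p \<in> carrier_mat n n" "q * Y * q \<in> carrier_mat n n"
    using p q Y by (auto intro!: mult_carrier_mat[of _ n n])
  have "P * X * P = U * (p * Y * p) * mat_adjoint U"
    unfolding P p_def[symmetric] XY using p Y
    by (simp add: unitary_conj_mult[OF unitary] mult_carrier_mat[of _ n n])
  moreover have QXQ: "(1\<^sub>m n - P) * X * (1\<^sub>m n - P) = U * (q * Y * q) * mat_adjoint U"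
    unfolding Q XY using q Y
    by (simp add: unitary_conj_mult[OF unitary] mult_carrier_mat[of _ n n])
  moreover have "evolve ((1\<^sub>m n - P) * X * (1\<^sub>m n - P)) = U * dephase (q * Y * q) * mat_adjoint U"
    unfolding QXQ evolve_eq[OF conj_carrier[OF Z(2)]] unitary_conj_cancel(2)[OF unitary Z(2)] ..
  ultimately have "measure_map n P evolve X - evolve X
      = U * (p * Y * p + dephase (q * Y * q) - dephase Y) * mat_adjoint U"
    unfolding measure_map_def evolve_eq[OF X] Y_def[symmetric]
    using Z dephase_carrier by (simp add: conj_add conj_minus)
  also have "p * Y * p + dephase (q * Y * q) - dephase Y = Matrix.mat n n (\<lambda>(i, j).
      if (i = k) = (j = k) then 0 else - (char_fun M T (d j - d i) * Y $$ (i, j)))"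
  proof (rule eq_matI)
    fix i j assume "i < dim_row (Matrix.mat n n (\<lambda>(i, j).
      if (i = k) = (j = k) then 0 else - (char_fun M T (d j - d i) * Y $$ (i, j))))"
      "j < dim_col (Matrix.mat n n (\<lambda>(i, j).
      if (i = k) = (j = k) then 0 else - (char_fun M T (d j - d i) * Y $$ (i, j))))"
    then have ij: "i < n" "j < n" by auto
    have "(p * Y * p) $$ (i, j) = (if i = k \<and> j = k then Y $$ (i, j) else 0)"
      "(q * Y * q) $$ (i, j) = (if i = k \<or> j = k then 0 else Y $$ (i, j))"
      unfolding p_def q_def index_diag_mult_diag[OF Y ij] by auto
    then show "(p * Y * p + dephase (q * Y * q) - dephase Y) $$ (i, j) = Matrix.mat n n (\<lambda>(i, j).
      if (i = k) = (j = k) then 0 else - (char_fun M T (d j - d i) * Y $$ (i, j))) $$ (i, j)"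
      using ij Z Y by (auto simp: dephase_def char_fun_0 simp del: index_mult_mat(1))
  qed (use p in \<open>auto simp: dephase_def\<close>)
  finally show ?thesis .
qed

lemma trace_norm_measure_map_minus_evolve_le:
  assumes \<rho>: "density_mat n \<rho>" and k: "k < n"
    and P: "P = U * diag_of n (\<lambda>i. if i = k then 1 else 0) * mat_adjoint U"
    and \<epsilon>: "0 \<le> \<epsilon>" "\<And>j. j < n \<Longrightarrow> j \<noteq> k \<Longrightarrow> cmod (char_fun M T (d k - d j)) \<le> \<epsilon>"
  shows "trace_norm (measure_map n P evolve \<rho> - evolve \<rho>) \<le> \<epsilon>"
proof -
  have psd: "psd_mat n \<rho>" and tr: "mat_trace \<rho> = 1" using \<rho> by (auto simp: density_mat_def)
  note \<rho>' = psd_matD(1)[OF psd]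
  define Y where "Y = mat_adjoint U * \<rho> * U"
  have Y: "psd_mat n Y"
    using psd_mat_conj[OF psd mat_adjoint_carrier[OF U(1)]] by (simp add: Y_def)
  have Ytr: "mat_trace Y = 1"
    unfolding Y_def mat_trace_unitary_conj(2)[OF unitary \<rho>'] by (rule tr)
  define w where "w i = (if i = k then 0 else - (char_fun M T (d k - d i) * Y $$ (i, k)))" for i
  have "Matrix.mat n n (\<lambda>(i, j). if (i = k) = (j = k) then 0 else - (char_fun M T (d j - d i) * Y $$ (i, j)))
      = Matrix.mat n n (\<lambda>(i, j). (if j = k then w i else 0) + (if i = k then cnj (w j) else 0))"
  proof (rule eq_matI, goal_cases)
    case (1 i j)
    \<comment> \<open>The conjugate symmetry of \<Phi> and of \<open>Y\<close> makes row
      \<open>k\<close> the conjugate of column \<open>k\<close>, which is the shape that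
      \<open>trace_norm_cross\<close> requires.\<close>
    have "char_fun M T (d j - d k) * Y $$ (k, j) = cnj (char_fun M T (d k - d j) * Y $$ (j, k))"
      using psd_mat_cnj[OF Y _ k, of j] char_fun_minus[of "d k - d j"] 1 by simp
    with 1 show ?case by (auto simp: w_def)
  qed auto
  then have "trace_norm (measure_map n P evolve \<rho> - evolve \<rho>) = 2 * sqrt (\<Sum>i<n. (cmod (w i))\<^sup>2)"
    unfolding measure_map_minus_evolve[OF \<rho>' k P] Y_def[symmetric]
    using trace_norm_cross[OF unitary k, of w] by (simp add: w_def)
  also have "(\<Sum>i<n. (cmod (w i))\<^sup>2) = (\<Sum>i\<in>{..<n} - {k}. (cmod (w i))\<^sup>2)"
    using k by (subst sum.remove[of _ k]) (auto simp: w_def)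
  also have "\<dots> \<le> (\<Sum>i\<in>{..<n} - {k}. \<epsilon>\<^sup>2 * (cmod (Y $$ (i, k)))\<^sup>2)"
    using \<epsilon> by (intro sum_mono) (auto simp: w_def norm_mult power_mult_distrib intro!: mult_right_mono power_mono)
  \<comment> \<open>The square root of this bound is \<epsilon>/2, to be doubled by the trace norm
    formula.\<close>
  also have "\<dots> \<le> \<epsilon>\<^sup>2 * (1 / 4)"
    unfolding sum_distrib_left[symmetric] by (intro mult_left_mono density_column_bound[OF Y Ytr k]) simp
  also have "\<dots> = (\<epsilon> / 2)\<^sup>2" by (simp add: power_divide)
  finally show ?thesis using \<epsilon>(1) by (simp add: real_sqrt_le_iff)
qed

end

theorem theorem1:
  fixes n :: nat and H :: "complex mat" and \<psi> :: "complex Matrix.vec" and E :: real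
    and M :: "'s measure" and T :: "'s \<Rightarrow> real"
  assumes herm: "hermitian_mat n H"
    and psi_dim: "\<psi> \<in> carrier_vec n"
    and psi_norm: "\<psi> \<bullet>c \<psi> = 1"
    and eig: "H *\<^sub>v \<psi> = complex_of_real E \<cdot>\<^sub>v \<psi>"
    and nondeg: "\<forall>v \<in> carrier_vec n. H *\<^sub>v v = complex_of_real E \<cdot>\<^sub>v v \<longrightarrow> (\<exists>c. v = c \<cdot>\<^sub>v \<psi>)"
    and prob: "prob_space M"
    and T_rv: "T \<in> borel_measurable M"
  shows "\<exists>\<E>. quantum_operation n \<E> \<and>
     (\<forall>\<rho>. density_mat n \<rho> \<longrightarrow>
        trace_norm (measure_map n (proj \<psi>) \<E> \<rho> - random_evolution n H M T \<rho>)
          \<le> Sup (insert 0 ((\<lambda>e. cmod (char_fun M T (E - e))) ` other_eigenvalues n H E)))"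
proof -
  obtain U d where U: "unitary_mat n U"
    and H: "H = U * diag_of n (\<lambda>i. complex_of_real (d i)) * mat_adjoint U"
    using hermitian_spectral[OF herm] by blast
  interpret diagonal_random_evolution M T n H U d
    using prob T_rv U H by (simp add: diagonal_random_evolution_def diagonal_random_evolution_axioms_def)
  obtain k where k: "k < n" "d k = E" "\<And>j. j < n \<Longrightarrow> j \<noteq> k \<Longrightarrow> d j \<noteq> E"
    and P: "proj \<psi> = U * diag_of n (\<lambda>i. if i = k then 1 else 0) * mat_adjoint U"
    using nondegenerate_eigenvector_column[OF unitary H psi_dim psi_norm eig nondeg] by blast
  \<comment> \<open>The element 0 keeps the set nonempty when \<open>E\<close> is the only
    eigenvalue, as for \<open>n = 1\<close>; the supremum is then 0.\<close>
  let ?S = "insert 0 ((\<lambda>e. cmod (char_fun M T (E - e))) ` other_eigenvalues n H E)"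
  \<comment> \<open>The bound 1 on characteristic functions suffices, so finiteness of the spectrum
    need not be shown.\<close>
  have bdd: "bdd_above ?S"
    by (rule bdd_aboveI[of _ 1]) (auto simp: norm_char_fun_le)
  have "trace_norm (measure_map n (proj \<psi>) evolve \<rho> - evolve \<rho>) \<le> Sup ?S" if "density_mat n \<rho>" for \<rho>
  proof (rule trace_norm_measure_map_minus_evolve_le[OF that k(1) P])
    show "0 \<le> Sup ?S" by (rule cSup_upper[OF _ bdd]) simp
    fix j assume j: "j < n" "j \<noteq> k"
    have "d j \<in> other_eigenvalues n H E"
      using unitary_diag_eigenvector(1)[OF unitary j(1), of "\<lambda>i. complex_of_real (d i)"]
        unitary_diag_eigenvector(2,3)[OF unitary j(1)] k(3)[OF j] H
      by (auto simp: other_eigenvalues_def)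
    then show "cmod (char_fun M T (d k - d j)) \<le> Sup ?S"
      unfolding k(2) by (intro cSup_upper[OF _ bdd]) auto
  qed
  then show ?thesis using quantum_operation_evolve by blast
qed

end
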